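(* Let $(\mathfrak B,\beta)$ be a unital separable $\mathbb Z_2$-graded $C^*$-algebra and let $\mathfrak A$ be its infinite Fermi $C^*$-tensor product over $\mathbb N$, with the natural action $\alpha$ of the group $\mathbb P$ of finite permutations of $\mathbb N$. Let $\omega\in\mathcal S_{\mathbb P}(\mathfrak A)$ be a symmetric state. Then the following are equivalent: (i) $\omega$ is ergodic; (ii) $\omega$ is strongly clustering; (iii) $\omega=\times_{\mathbb N}\varphi$ for some even state $\varphi\in\mathcal S_+(\mathfrak B)$.
   Context: Graded algebras. A $\mathbb Z_2$-graded $C^*$-algebra is a pair $(\mathfrak C,\gamma)$ with $\mathfrak C$ a $C^*$-algebra and $\gamma$ a $*$-automorphism with $\gamma^2=\mathrm{id}$. Put $\mathfrak C_\pm=\{a:\gamma(a)=\pm a\}$ (even/odd elements; the elements of $\mathfrak C_+\cup\mathfrak C_-$ are homogeneous). A state $\varphi$ is even if $\varphi\circ\gamma=\varphi$ (equivalently $\varphi$ vanishes on $\mathfrak C_-$); $\mathcal S_+(\mathfrak C)$ is the set of even states. Fermi tensor product. For $\mathbb Z_2$-graded $C^*$-algebras $(\mathfrak C,\gamma),(\mathfrak D,\delta)$, the algebraic Fermi product $\mathfrak C\odot_F\mathfrak D$ is the algebraic tensor product $\mathfrak C\odot\mathfrak D$ with product and involution determined on homogeneous elements by $(c\odot d)(c'\odot d')=\epsilon(d,c')\,cc'\odot dd'$ and $(c\odot d)^*=\epsilon(c,d)\,c^*\odot d^*$, where $\epsilon(x,y)=-1$ if $x,y$ are both odd and $1$ otherwise.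 For even states $\varphi,\psi$, the functional $(\varphi\times\psi)(c\odot d)=\varphi(c)\psi(d)$ is positive on $\mathfrak C\odot_F\mathfrak D$ and its GNS representation $\pi_{\varphi\times\psi}$ is by bounded operators. The Fermi $C^*$-tensor product $\mathfrak C\otimes_F\mathfrak D$ is the completion of $\mathfrak C\odot_F\mathfrak D$ in the $C^*$-norm $\|x\|=\sup\{\|\pi_{\varphi\times\psi}(x)\|:\varphi\in\mathcal S_+(\mathfrak C),\psi\in\mathcal S_+(\mathfrak D)\}$; it is $\mathbb Z_2$-graded by the extension of $\gamma\otimes_F\delta: c\odot d\mapsto\gamma(c)\odot\delta(d)$. Infinite product. With $\mathfrak B^{(1)}=\mathfrak B$ and $\mathfrak B^{(n+1)}=\mathfrak B^{(n)}\otimes_F\mathfrak B$, the infinite Fermi $C^*$-tensor product $(\mathfrak A,\theta)$ is the $C^*$-inductive limit of the $\mathfrak B^{(n)}$ under the grading-preserving embeddings $a\mapsto a\otimes_F 1$, with the induced grading. For $j\in\mathbb N=\{0,1,2,\dots\}$, $\iota_j:\mathfrak B\to\mathfrak A$ is the embedding in the $j$-th factor (identity in all other factors); for $i\ne j$ the elements $\iota_i(a),\iota_j(b)$ with $a,b$ homogeneous commute, except that they anticommute if both are odd. For $\varphi\in\mathcal S_+(\mathfrak B)$, $\times_{\mathbb N}\varphi$ is the unique state on $\mathfrak A$ with $(\times_{\mathbb N}\varphi)(\iota_0(a_0)\cdots\iota_n(a_n))=\prod_{j=0}^n\varphi(a_j)$ for all $n$ and $a_j\in\mathfrak B$. Symmetric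 states. $\mathbb P$ is the group of permutations of $\mathbb N$ moving only finitely many indices, acting on $\mathfrak A$ by the $*$-automorphisms $\alpha_g$ determined by $\alpha_g\circ\iota_j=\iota_{g(j)}$. $\mathcal S_{\mathbb P}(\mathfrak A)$ is the weak-$*$ compact convex set of states with $\omega\circ\alpha_g=\omega$ for all $g\in\mathbb P$ (symmetric states); a symmetric state is ergodic if it is an extreme point of $\mathcal S_{\mathbb P}(\mathfrak A)$. It is strongly clustering if there is a sequence $(g_n)_n\subset\mathbb P$ such that $\lim_n\omega(\alpha_{g_n}(a)b)=\omega(a)\omega(b)$ for every $a,b\in\mathfrak A$. *)

theory Defs
  imports
    "HOL-Analysis.Analysis"
    "HOL-Library.Function_Algebras"
    "HOL-Library.Nonpos_Ints"
begin

section \<open>Unital $C^*$-algebras\<close>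

text \<open>
  Unital complex $C^*$-algebras. The superclass \<^class>\<open>real_normed_algebra_1\<close> demands
  \<open>norm 1 = 1\<close>, so that only the zero algebra (which has no state) is left out.
\<close>

class cstar_algebra = real_normed_algebra_1 + banach +
  fixes scaleC :: "complex \<Rightarrow> 'a \<Rightarrow> 'a" (infixr \<open>*\<^sub>C\<close> 75)
    and star :: "'a \<Rightarrow> 'a"
  assumes scaleC_add_right: "z *\<^sub>C (x + y) = z *\<^sub>C x + z *\<^sub>C y"
    and scaleC_add_left: "(z + w) *\<^sub>C x = z *\<^sub>C x + w *\<^sub>C x"
    and scaleC_scaleC: "z *\<^sub>C w *\<^sub>C x = (z * w) *\<^sub>C x"
    and scaleC_of_real: "complex_of_real r *\<^sub>C x = r *\<^sub>R x"
    and scaleC_mult_left: "(z *\<^sub>C x) * y = z *\<^sub>C (x * y)"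
    and scaleC_mult_right: "x * (z *\<^sub>C y) = z *\<^sub>C (x * y)"
    and norm_scaleC: "norm (z *\<^sub>C x) = cmod z * norm x"
    and star_add: "star (x + y) = star x + star y"
    and star_scaleC: "star (z *\<^sub>C x) = cnj z *\<^sub>C star x"
    and star_mult: "star (x * y) = star y * star x"
    and star_star: "star (star x) = x"
    and cstar_identity: "norm (star x * x) = (norm x)\<^sup>2"

global_interpretation cvector: vector_space "scaleC :: complex \<Rightarrow> 'a \<Rightarrow> 'a::cstar_algebra"
  defines cspan = cvector.span
    and cdependent = cvector.dependent
proof
  fix z w :: complex and x y :: 'a
  show "1 *\<^sub>C x = x"
    using scaleC_of_real[of 1 x] by simp
qed (simp_all add: scaleC_add_right scaleC_add_left scaleC_scaleC)

text \<open>
  A $C^*$-algebra is represented by a unital $C^*$-subalgebra of some type of class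
  \<^class>\<open>cstar_algebra\<close> (possibly all of it, \<^term>\<open>UNIV\<close>). Maps on it are HOL functions whose
  values outside the carrier are irrelevant.
\<close>

definition cstar_subalgebra :: "'a::cstar_algebra set \<Rightarrow> bool" where
  "cstar_subalgebra S \<longleftrightarrow> closed S \<and> 1 \<in> S \<and>
     (\<forall>a\<in>S. \<forall>b\<in>S. a + b \<in> S \<and> a * b \<in> S) \<and>
     (\<forall>z. \<forall>a\<in>S. z *\<^sub>C a \<in> S) \<and> (\<forall>a\<in>S. star a \<in> S)"

definition clinear_on :: "'a::cstar_algebra set \<Rightarrow> (complex \<Rightarrow> 'b \<Rightarrow> 'b) \<Rightarrow> ('a \<Rightarrow> 'b::ab_group_add) \<Rightarrow> bool" where
  "clinear_on S scl f \<longleftrightarrow>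
     (\<forall>a\<in>S. \<forall>b\<in>S. f (a + b) = f a + f b) \<and> (\<forall>z. \<forall>a\<in>S. f (z *\<^sub>C a) = scl z (f a))"

definition star_isomorphism ::
    "'a::cstar_algebra set \<Rightarrow> 'b::cstar_algebra set \<Rightarrow> ('a \<Rightarrow> 'b) \<Rightarrow> bool" where
  "star_isomorphism S S' f \<longleftrightarrow> bij_betw f S S' \<and> clinear_on S scaleC f \<and>
     (\<forall>a\<in>S. \<forall>b\<in>S. f (a * b) = f a * f b) \<and> (\<forall>a\<in>S. f (star a) = star (f a))"

definition state_on :: "'a::cstar_algebra set \<Rightarrow> ('a \<Rightarrow> complex) \<Rightarrow> bool" where
  "state_on S \<phi> \<longleftrightarrow> clinear_on S (*) \<phi> \<and> (\<forall>a\<in>S. \<phi> (star a * a) \<in> \<real>\<^sub>\<ge>\<^sub>0) \<and> \<phi> 1 = 1"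


section \<open>Graded $C^*$-algebras\<close>

definition graded_cstar_algebra :: "'a::cstar_algebra set \<Rightarrow> ('a \<Rightarrow> 'a) \<Rightarrow> bool" where
  "graded_cstar_algebra S \<gamma> \<longleftrightarrow>
     cstar_subalgebra S \<and> star_isomorphism S S \<gamma> \<and> (\<forall>a\<in>S. \<gamma> (\<gamma> a) = a)"

definition homogeneous :: "'a::cstar_algebra set \<Rightarrow> ('a \<Rightarrow> 'a) \<Rightarrow> 'a set" where
  "homogeneous S \<gamma> = {a \<in> S. \<gamma> a = a} \<union> {a \<in> S. \<gamma> a = - a}"

definition fermi_sign ::
    "('a::cstar_algebra \<Rightarrow> 'a) \<Rightarrow> ('b::cstar_algebra \<Rightarrow> 'b) \<Rightarrow> 'a \<Rightarrow> 'b \<Rightarrow> complex" where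
  "fermi_sign \<gamma> \<delta> x y = (if \<gamma> x = - x \<and> \<delta> y = - y then - 1 else 1)"

definition even_states :: "'a::cstar_algebra set \<Rightarrow> ('a \<Rightarrow> 'a) \<Rightarrow> ('a \<Rightarrow> complex) set" where
  "even_states S \<gamma> = {\<phi>. state_on S \<phi> \<and> (\<forall>a\<in>S. \<phi> (\<gamma> a) = \<phi> a)}"


section \<open>The Fermi tensor product\<close>

text \<open>
  \<open>T c d\<close> is the elementary tensor of \<open>c\<close> and \<open>d\<close>. The last conjunct says that the linear map
  from the algebraic tensor product of \<open>C\<close> and \<open>D\<close> induced by the bilinear map \<open>T\<close> is injective;
  thus the span of the elementary tensors is the algebraic tensor product.
\<close>

definition algebraic_tensor :: "'c::cstar_algebra set \<Rightarrow> 'd::cstar_algebra set \<Rightarrow>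
    ('c \<Rightarrow> 'd \<Rightarrow> 'e::cstar_algebra) \<Rightarrow> bool" where
  "algebraic_tensor C D T \<longleftrightarrow>
     (\<forall>d\<in>D. clinear_on C scaleC (\<lambda>c. T c d)) \<and> (\<forall>c\<in>C. clinear_on D scaleC (T c)) \<and>
     (\<forall>F d. finite F \<longrightarrow> F \<subseteq> C \<longrightarrow> \<not> cdependent F \<longrightarrow> (\<forall>c\<in>F. d c \<in> D) \<longrightarrow>
        (\<Sum>c\<in>F. T c (d c)) = 0 \<longrightarrow> (\<forall>c\<in>F. d c = 0))"

definition tensor_span :: "'c::cstar_algebra set \<Rightarrow> 'd::cstar_algebra set \<Rightarrow>
    ('c \<Rightarrow> 'd \<Rightarrow> 'e::cstar_algebra) \<Rightarrow> 'e set" where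
  "tensor_span C D T = cspan {T c d | c d. c \<in> C \<and> d \<in> D}"

definition product_functionals :: "'c::cstar_algebra set \<Rightarrow> 'd::cstar_algebra set \<Rightarrow>
    ('c \<Rightarrow> 'd \<Rightarrow> 'e::cstar_algebra) \<Rightarrow> ('c \<Rightarrow> complex) \<Rightarrow> ('d \<Rightarrow> complex) \<Rightarrow> ('e \<Rightarrow> complex) set" where
  "product_functionals C D T \<phi> \<psi> =
     {\<rho>. clinear_on (tensor_span C D T) (*) \<rho> \<and> (\<forall>c\<in>C. \<forall>d\<in>D. \<rho> (T c d) = \<phi> c * \<psi> d)}"

text \<open>
  The GNS space of a positive functional \<open>\<rho>\<close> on a unital $*$-algebra \<open>E\<close> is the completion of \<open>E\<close>
  modulo null vectors for the semi-inner product \<open>(y, z) \<mapsto> \<rho> (star y * z)\<close>, and \<open>x\<close> acts on it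
  by left multiplication. Below is the operator norm of this action, computed on the dense
  subspace of classes of elements of \<open>E\<close>; it is \<open>\<infinity>\<close> if the action is unbounded.
\<close>

definition gns_norm :: "'e::cstar_algebra set \<Rightarrow> ('e \<Rightarrow> complex) \<Rightarrow> 'e \<Rightarrow> ennreal" where
  "gns_norm E \<rho> x = (SUP y\<in>{y \<in> E. Re (\<rho> (star y * y)) \<le> 1}.
     ennreal (sqrt (Re (\<rho> (star (x * y) * (x * y))))))"

text \<open>
  \<open>(E, \<epsilon>)\<close>, with \<open>T\<close> as elementary tensors, is the Fermi $C^*$-tensor product of \<open>(C, \<gamma>)\<close> and
  \<open>(D, \<delta>)\<close>: it contains the algebraic Fermi product as a dense $*$-subalgebra, on which its norm
  is the supremum of the GNS norms of the products of even states. This determines it up to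
  isomorphism.
\<close>

definition fermi_tensor_product :: "'c::cstar_algebra set \<Rightarrow> ('c \<Rightarrow> 'c) \<Rightarrow>
    'd::cstar_algebra set \<Rightarrow> ('d \<Rightarrow> 'd) \<Rightarrow> 'e::cstar_algebra set \<Rightarrow> ('e \<Rightarrow> 'e) \<Rightarrow>
    ('c \<Rightarrow> 'd \<Rightarrow> 'e) \<Rightarrow> bool" where
  "fermi_tensor_product C \<gamma> D \<delta> E \<epsilon> T \<longleftrightarrow>
     graded_cstar_algebra C \<gamma> \<and> graded_cstar_algebra D \<delta> \<and> graded_cstar_algebra E \<epsilon> \<and>
     algebraic_tensor C D T \<and>
     (\<forall>c\<in>homogeneous C \<gamma>. \<forall>d\<in>homogeneous D \<delta>. \<forall>c'\<in>homogeneous C \<gamma>. \<forall>d'\<in>homogeneous D \<delta>.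
        T c d * T c' d' = fermi_sign \<delta> \<gamma> d c' *\<^sub>C T (c * c') (d * d')) \<and>
     (\<forall>c\<in>homogeneous C \<gamma>. \<forall>d\<in>homogeneous D \<delta>.
        star (T c d) = fermi_sign \<gamma> \<delta> c d *\<^sub>C T (star c) (star d)) \<and>
     (\<forall>c\<in>C. \<forall>d\<in>D. \<epsilon> (T c d) = T (\<gamma> c) (\<delta> d)) \<and>
     E = closure (tensor_span C D T) \<and>
     (\<forall>x\<in>tensor_span C D T. ennreal (norm x) =
        (SUP \<rho>\<in>(\<Union>\<phi>\<in>even_states C \<gamma>. \<Union>\<psi>\<in>even_states D \<delta>. product_functionals C D T \<phi> \<psi>).
           gns_norm (tensor_span C D T) \<rho> x))"


section \<open>The infinite Fermi tensor product\<close>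

text \<open>
  Here \<open>\<BB> n\<close> is the Fermi product of \<open>n + 1\<close> copies of the graded algebra \<open>('b, \<beta>)\<close>. The
  connecting maps \<open>a \<mapsto> T n a 1\<close> of the inductive system are isometric, so that its
  $C^*$-inductive limit is the $C^*$-algebra \<open>'a\<close> in which the \<open>\<BB> n\<close> form an increasing
  sequence of $C^*$-subalgebras with dense union, the connecting maps being the inclusions; the
  grading \<open>\<theta>\<close> of the limit restricts to that of every \<open>\<BB> n\<close>. The map \<open>\<iota> j\<close> embeds \<open>'b\<close> as
  \<open>j\<close>-th factor.
\<close>

definition infinite_fermi_product ::
    "('b::cstar_algebra \<Rightarrow> 'b) \<Rightarrow> ('a::cstar_algebra \<Rightarrow> 'a) \<Rightarrow> (nat \<Rightarrow> 'b \<Rightarrow> 'a) \<Rightarrow> bool" where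
  "infinite_fermi_product \<beta> \<theta> \<iota> \<longleftrightarrow>
     graded_cstar_algebra UNIV \<beta> \<and> graded_cstar_algebra UNIV \<theta> \<and>
     (\<exists>(\<BB> :: nat \<Rightarrow> 'a set) (T :: nat \<Rightarrow> 'a \<Rightarrow> 'b \<Rightarrow> 'a).
        star_isomorphism UNIV (\<BB> 0) (\<iota> 0) \<and> (\<forall>b. \<theta> (\<iota> 0 b) = \<iota> 0 (\<beta> b)) \<and>
        (\<forall>n. fermi_tensor_product (\<BB> n) \<theta> UNIV \<beta> (\<BB> (Suc n)) \<theta> (T n)) \<and>
        (\<forall>n. \<forall>a\<in>\<BB> n. T n a 1 = a) \<and>
        (\<forall>n b. \<iota> (Suc n) b = T n 1 b) \<and>
        closure (\<Union>n. \<BB> n) = UNIV)"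

definition finite_permutations :: "(nat \<Rightarrow> nat) set" where
  "finite_permutations = {g. bij g \<and> finite {j. g j \<noteq> j}}"

text \<open>The automorphisms \<open>\<alpha> g\<close> are uniquely determined by the following conditions.\<close>

definition permutation_action ::
    "(nat \<Rightarrow> 'b::cstar_algebra \<Rightarrow> 'a::cstar_algebra) \<Rightarrow> ((nat \<Rightarrow> nat) \<Rightarrow> 'a \<Rightarrow> 'a) \<Rightarrow> bool" where
  "permutation_action \<iota> \<alpha> \<longleftrightarrow>
     (\<forall>g\<in>finite_permutations. star_isomorphism UNIV UNIV (\<alpha> g) \<and> (\<forall>j. \<alpha> g \<circ> \<iota> j = \<iota> (g j)))"

text \<open>
  This determines the state \<open>\<omega>\<close> uniquely, because the products
  \<open>\<iota> 0 (b 0) * \<dots> * \<iota> n (b n)\<close> span a dense subspace.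
\<close>

definition is_product_state ::
    "(nat \<Rightarrow> 'b::cstar_algebra \<Rightarrow> 'a::cstar_algebra) \<Rightarrow> ('b \<Rightarrow> complex) \<Rightarrow> ('a \<Rightarrow> complex) \<Rightarrow> bool" where
  "is_product_state \<iota> \<phi> \<omega> \<longleftrightarrow> state_on UNIV \<omega> \<and>
     (\<forall>n b. \<omega> (prod_list (map (\<lambda>j. \<iota> j (b j)) [0..<Suc n])) = (\<Prod>j\<le>n. \<phi> (b j)))"


section \<open>Symmetric states\<close>

definition symmetric_states ::
    "((nat \<Rightarrow> nat) \<Rightarrow> 'a::cstar_algebra \<Rightarrow> 'a) \<Rightarrow> ('a \<Rightarrow> complex) set" where
  "symmetric_states \<alpha> = {\<omega>. state_on UNIV \<omega> \<and> (\<forall>g\<in>finite_permutations. \<omega> \<circ> \<alpha> g = \<omega>)}"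

text \<open>
  The pointwise real vector space structure on functions, needed for
  \<^const>\<open>extreme_point_of\<close>.
\<close>

instantiation "fun" :: (type, real_vector) real_vector
begin

definition scaleR_fun :: "real \<Rightarrow> ('a \<Rightarrow> 'b) \<Rightarrow> 'a \<Rightarrow> 'b" where
  "scaleR_fun r f = (\<lambda>x. r *\<^sub>R f x)"

instance
  by standard (simp_all add: scaleR_fun_def fun_eq_iff scaleR_add_right scaleR_add_left)

end

definition ergodic_state ::
    "((nat \<Rightarrow> nat) \<Rightarrow> 'a::cstar_algebra \<Rightarrow> 'a) \<Rightarrow> ('a \<Rightarrow> complex) \<Rightarrow> bool" where
  "ergodic_state \<alpha> \<omega> \<longleftrightarrow> \<omega> extreme_point_of symmetric_states \<alpha>"

definition strongly_clustering ::
    "((nat \<Rightarrow> nat) \<Rightarrow> 'a::cstar_algebra \<Rightarrow> 'a) \<Rightarrow> ('a \<Rightarrow> complex) \<Rightarrow> bool" where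
  "strongly_clustering \<alpha> \<omega> \<longleftrightarrow> (\<exists>g :: nat \<Rightarrow> nat \<Rightarrow> nat. (\<forall>n. g n \<in> finite_permutations) \<and>
     (\<forall>a b. (\<lambda>n. \<omega> (\<alpha> (g n) a * b)) \<longlonglongrightarrow> \<omega> a * \<omega> b))"

end

theory Submission
  imports Defs
begin

text \<open>
  The passage from extremality to the product form is where the mathematics lies. Let \<open>\<omega>\<close> be a
  symmetric state and \<open>\<phi>\<close> its restriction to one factor. For \<open>x\<close> in finitely many factors the
  number \<open>\<omega> (\<iota> k b * x)\<close> is the same for all \<open>k\<close> beyond these factors, because a transposition moves
  one such \<open>k\<close> to another without touching \<open>x\<close>. Hence \<open>\<omega> (\<iota> k b * x)\<close> converges for all \<open>x\<close> as \<open>k\<close>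
  grows, and the limit \<open>\<rho> x\<close> is again invariant under permutations. If \<open>b = star c * c\<close> is even, then
  \<open>\<iota> k b\<close> eventually commutes with local elements, so that \<open>\<rho>\<close> is positive; if \<open>1 - b\<close> is of this form
  too, \<open>\<rho>\<close> is dominated by \<open>\<omega>\<close>. An extreme \<open>\<omega>\<close> then forces \<open>\<rho> = \<phi> b \<cdot> \<omega>\<close>, which says that a factor far
  out splits off. Elements \<open>b = (1 + h) / 2\<close> with \<open>h\<close> even, self-adjoint and of norm below \<open>1\<close> satisfy
  both conditions and span the even part of the factor
  (\<open>ergodic_dominated_functional\<close>, \<open>ergodic_asymptotic\<close>, \<open>ergodic_imp_product\<close>).

  For odd \<open>b\<close> the limit vanishes for every symmetric state (\<open>odd_factor_vanishes\<close>). The sum \<open>Y\<close> of \<open>K\<close>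
  copies of \<open>b\<close> in different factors satisfies \<open>\<omega> (Y * x) = K \<cdot> \<omega> (\<iota> k b * x)\<close>; but the copies
  anticommute, so that in \<open>star Y * Y + Y * star Y\<close> only the \<open>K\<close> diagonal terms survive, and the
  Cauchy-Schwarz inequality bounds \<open>\<omega> (Y * x)\<close> by a multiple of \<open>sqrt K\<close>. In particular the
  restriction \<open>\<phi>\<close> is even.

  A product state clusters along the permutations that reverse \<open>{0..N}\<close>: they carry a product
  \<open>\<iota> 0 b\<^sub>0 * \<dots> * \<iota> m b\<^sub>m\<close> to one in which the leftmost factor has the largest index, so the factors can
  be split off one at a time from the left (\<open>product_reversed\<close>).

  That a strongly clustering \<open>\<omega>\<close> is extreme is a Banach-Saks argument
  (\<open>strongly_clustering_dominated\<close>). Suppose \<open>\<psi>\<close> is a symmetric state dominated by a multiple of \<open>\<omega>\<close>,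
  and \<open>\<omega> b = 0\<close>. Translates of \<open>b\<close> tend weakly to \<open>0\<close> for the inner product of \<open>\<omega>\<close>, so \<open>K\<close> of them can be
  chosen almost orthogonal; on their sum \<open>\<psi>\<close> takes the value \<open>K \<cdot> \<psi> b\<close>, whereas domination bounds it
  by a multiple of \<open>sqrt K\<close>. Thus \<open>\<psi> b = 0\<close>, whence \<open>\<psi> = \<omega>\<close>.
\<close>

section \<open>Unital $C^*$-algebras\<close>

lemma star_zero [simp]: "star (0::'a::cstar_algebra) = 0"
  using star_add[of 0 "0::'a"] by simp

lemma star_minus: "star (- x) = - star (x::'a::cstar_algebra)"
  using star_add[of x "- x"] by (simp add: eq_neg_iff_add_eq_0 add.commute)

lemma star_diff: "star (x - y) = star x - star (y::'a::cstar_algebra)"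
  using star_add[of x "- y"] by (simp add: star_minus)

lemma star_one [simp]: "star (1::'a::cstar_algebra) = 1"
  by (metis mult.left_neutral mult.right_neutral star_mult star_star)

lemma star_scaleR: "star (r *\<^sub>R x) = r *\<^sub>R star (x::'a::cstar_algebra)"
  by (metis complex_cnj_complex_of_real scaleC_of_real star_scaleC)

lemma star_power: "star (x ^ n) = star (x::'a::cstar_algebra) ^ n"
  by (induction n) (simp_all add: star_mult power_commutes)

lemma norm_star [simp]: "norm (star x) = norm (x::'a::cstar_algebra)"
proof -
  have le: "norm y \<le> norm (star y)" for y :: 'a
  proof (cases "norm y = 0")
    case False
    have "norm y * norm y \<le> norm (star y) * norm y"
      using cstar_identity[of y] norm_mult_ineq[of "star y" y] by (simp add: power2_eq_square)
    with False show ?thesis by simp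
  qed simp
  show ?thesis using le[of x] le[of "star x"] by (simp add: star_star)
qed

lemma bounded_linear_star: "bounded_linear (star :: 'a::cstar_algebra \<Rightarrow> 'a)"
  by (rule bounded_linear_intro[where K = 1]) (simp_all add: star_add star_scaleR)

lemma scaleC_one [simp]: "1 *\<^sub>C x = (x::'a::cstar_algebra)"
  using scaleC_of_real[of 1 x] by simp

lemma scaleC_minus_one [simp]: "(- 1) *\<^sub>C x = - (x::'a::cstar_algebra)"
  using scaleC_of_real[of "- 1" x] by simp

lemma scaleC_zero [simp]: "0 *\<^sub>C x = (0::'a::cstar_algebra)"
  using scaleC_of_real[of 0 x] by simp

lemma scaleC_diff_right: "z *\<^sub>C (x - y) = z *\<^sub>C x - z *\<^sub>C (y::'a::cstar_algebra)"
  by (rule cvector.scale_right_diff_distrib)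

text \<open>
  The binomial series of \<open>(1 + h)\<^sup>1\<^sup>/\<^sup>2\<close> converges absolutely for \<open>norm h < 1\<close>, and by Vandermonde's
  identity its Cauchy square is the (finite) binomial series of exponent \<open>1\<close>. This elementary square
  root takes the place of functional calculus below.
\<close>

lemma self_adjoint_sqrt:
  fixes h :: "'a::cstar_algebra"
  assumes sa: "star h = h" and small: "norm h < 1"
  shows "\<exists>s. star s = s \<and> s * s = 1 + h"
proof -
  define f where "f n = ((1/2::real) gchoose n) *\<^sub>R h ^ n" for n
  obtain r where r: "norm h < r" "r < 1" using small dense by blast
  with norm_ge_zero[of h] have r0: "0 < r" by linarith
  have "summable (\<lambda>n. ((1/2::real) gchoose n) * r ^ n)"
    using gen_binomial_real[of r "1/2"] r r0 by (auto simp: sums_iff)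
  then have "summable (\<lambda>n. norm (((1/2::real) gchoose n) * norm h ^ n))"
    by (rule powser_insidea) (use r r0 in auto)
  then have sn: "summable (\<lambda>n. norm (f n))"
    by (rule summable_comparison_test[rotated])
      (auto simp: f_def abs_mult intro!: exI[of _ 0] mult_left_mono norm_power_ineq)
  have "(\<Sum>i\<le>n. f i * f (n - i)) = ((1::real) gchoose n) *\<^sub>R h ^ n" for n
  proof -
    have "(\<Sum>i\<le>n. f i * f (n - i)) =
        (\<Sum>i\<le>n. (((1/2::real) gchoose i) * ((1/2) gchoose (n - i))) *\<^sub>R h ^ n)"
      by (rule sum.cong) (auto simp: f_def power_add[symmetric])
    also have "\<dots> = (\<Sum>i\<le>n. ((1/2::real) gchoose i) * ((1/2) gchoose (n - i))) *\<^sub>R h ^ n"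
      by (simp add: scaleR_sum_left)
    also have "(\<Sum>i\<le>n. ((1/2::real) gchoose i) * ((1/2) gchoose (n - i))) = (1 gchoose n)"
      using gbinomial_Vandermonde[of "1/2::real" "1/2" n] by (simp add: atLeast0AtMost)
    finally show ?thesis .
  qed
  with Cauchy_product_sums[OF sn sn]
  have "(\<lambda>n. ((1::real) gchoose n) *\<^sub>R h ^ n) sums (suminf f * suminf f)" by simp
  moreover have "(\<lambda>n. ((1::real) gchoose n) *\<^sub>R h ^ n) sums (\<Sum>n\<in>{..1}. ((1::real) gchoose n) *\<^sub>R h ^ n)"
  proof (rule sums_finite)
    fix n :: nat
    assume "n \<notin> {..1}"
    then have "(1::real) gchoose n = 0"
      using binomial_gbinomial[of 1 n, where 'a = real] by (simp add: binomial_eq_0)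
    then show "((1::real) gchoose n) *\<^sub>R h ^ n = 0" by simp
  qed simp
  ultimately have "suminf f * suminf f = 1 + h"
    by (simp add: sums_unique2)
  moreover have "star (f n) = f n" for n
    by (simp add: f_def star_scaleR star_power sa)
  then have "star (suminf f) = suminf f"
    using bounded_linear.suminf[OF bounded_linear_star summable_norm_cancel[OF sn]] by simp
  ultimately show ?thesis by blast
qed


section \<open>States\<close>

locale state =
  fixes \<omega> :: "'a::cstar_algebra \<Rightarrow> complex"
  assumes state: "state_on UNIV \<omega>"
begin

lemma add: "\<omega> (x + y) = \<omega> x + \<omega> y"
  and scale: "\<omega> (z *\<^sub>C x) = z * \<omega> x"
  and one: "\<omega> 1 = 1"
  and pos: "\<omega> (star x * x) \<in> \<real>\<^sub>\<ge>\<^sub>0"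
  using state by (auto simp: state_on_def clinear_on_def)

lemma zero: "\<omega> 0 = 0"
  using add[of 0 0] by simp

lemma minus: "\<omega> (- x) = - \<omega> x"
  using add[of x "- x"] by (simp add: zero eq_neg_iff_add_eq_0 add.commute)

lemma diff: "\<omega> (x - y) = \<omega> x - \<omega> y"
  using add[of x "- y"] by (simp add: minus)

lemma Re_pos: "0 \<le> Re (\<omega> (star x * x))"
  and Im_pos: "Im (\<omega> (star x * x)) = 0"
  using pos[of x] by (auto simp: complex_nonneg_Reals_iff)

text \<open>Positivity on \<open>x + 1\<close> and on \<open>x + \<i>\<close> yields the imaginary and the real part.\<close>

lemma hermitian: "\<omega> (star x) = cnj (\<omega> x)"
proof (rule complex_eqI)
  have "star (x + 1) * (x + 1) = star x * x + star x + x + 1"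
    by (simp add: star_add algebra_simps)
  with Im_pos[of "x + 1"] Im_pos[of x] show "Im (\<omega> (star x)) = Im (cnj (\<omega> x))"
    by (simp add: add one)
  have "star (x + \<i> *\<^sub>C 1) * (x + \<i> *\<^sub>C 1)
      = star x * x + \<i> *\<^sub>C star x + (- \<i>) *\<^sub>C x + 1"
    by (simp add: star_add star_scaleC scaleC_mult_left scaleC_mult_right scaleC_scaleC
        scaleC_diff_right distrib_left left_diff_distrib)
  with Im_pos[of "x + \<i> *\<^sub>C 1"] Im_pos[of x] show "Re (\<omega> (star x)) = Re (cnj (\<omega> x))"
    by (simp add: add diff scale one)
qed

lemma cauchy_schwarz:
  "(cmod (\<omega> (star x * y)))\<^sup>2 \<le> Re (\<omega> (star x * x)) * Re (\<omega> (star y * y))"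
proof -
  define w where "w = \<omega> (star x * y)"
  define A where "A = Re (\<omega> (star x * x))"
  define B where "B = Re (\<omega> (star y * y))"
  have yx: "\<omega> (star y * x) = cnj w"
    using hermitian[of "star x * y"] by (simp add: w_def star_mult star_star)
  \<comment> \<open>positivity on \<open>x + z y\<close> for \<open>z = - t \<cdot> cnj w\<close>, a quadratic inequality in \<open>t\<close>\<close>
  have key: "0 \<le> A - 2 * t * (cmod w)\<^sup>2 + t\<^sup>2 * (cmod w)\<^sup>2 * B" for t :: real
  proof -
    define z where "z = - (complex_of_real t * cnj w)"
    have "star (x + z *\<^sub>C y) * (x + z *\<^sub>C y)
        = star x * x + z *\<^sub>C (star x * y) + cnj z *\<^sub>C (star y * x) + (cnj z * z) *\<^sub>C (star y * y)"
      by (simp add: star_add star_scaleC scaleC_mult_left scaleC_mult_right scaleC_scaleC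
          scaleC_add_right distrib_left distrib_right add_ac)
    then have e: "\<omega> (star (x + z *\<^sub>C y) * (x + z *\<^sub>C y))
        = \<omega> (star x * x) + z * w + cnj z * cnj w + (cnj z * z) * \<omega> (star y * y)"
      by (simp add: add scale yx w_def)
    have "cnj z * z = complex_of_real (t\<^sup>2 * (cmod w)\<^sup>2)"
      by (simp add: z_def complex_eq_iff cmod_power2) (simp add: power2_eq_square algebra_simps)
    then have "Re ((cnj z * z) * \<omega> (star y * y)) = t\<^sup>2 * (cmod w)\<^sup>2 * B"
      by (simp only: B_def) simp
    moreover have "Re (z * w + cnj z * cnj w) = - 2 * t * (cmod w)\<^sup>2"
      unfolding cmod_power2 by (simp add: z_def power2_eq_square algebra_simps)
    ultimately show ?thesis
      using Re_pos[of "x + z *\<^sub>C y"] by (simp add: e A_def)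
  qed
  have B0: "0 \<le> B" and A0: "0 \<le> A" by (simp_all add: A_def B_def Re_pos)
  have "(cmod w)\<^sup>2 \<le> A * B"
  proof (cases "B = 0")
    case True
    show ?thesis
    proof (rule ccontr)
      assume "\<not> ?thesis"
      then have w: "(cmod w)\<^sup>2 > 0" using True by simp
      with key[of "(A + 1) / (cmod w)\<^sup>2"] True A0 show False by simp
    qed
  next
    case False
    with B0 have "B > 0" by simp
    with key[of "1 / B"] show ?thesis by (simp add: field_simps power2_eq_square)
  qed
  then show ?thesis by (simp add: w_def A_def B_def)
qed

text \<open>
  For \<open>c > (norm x)\<^sup>2\<close> the element \<open>1 - star x * x / c\<close> is the square of a self-adjoint element, on
  which \<open>\<omega>\<close> is nonnegative.
\<close>

lemma square_bound: "Re (\<omega> (star x * x)) \<le> (norm x)\<^sup>2"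
proof (rule field_le_epsilon)
  fix e :: real
  assume e: "e > 0"
  define c where "c = (norm x)\<^sup>2 + e"
  have c: "c > 0" using e by (simp add: c_def add_nonneg_pos)
  define h where "h = - ((1 / c) *\<^sub>R (star x * x))"
  have "star h = h" by (simp add: h_def star_minus star_scaleR star_mult star_star)
  moreover have "norm h < 1"
    using c e by (simp add: h_def cstar_identity c_def)
  ultimately obtain s where s: "star s = s" "s * s = 1 + h" using self_adjoint_sqrt by blast
  have "\<omega> (star s * s) = 1 - complex_of_real (1 / c) * \<omega> (star x * x)"
    by (simp add: s h_def diff one scale flip: scaleC_of_real)
  then have "0 \<le> 1 - Re (\<omega> (star x * x)) / c"
    using Re_pos[of s] by (simp add: Im_pos)
  then show "Re (\<omega> (star x * x)) \<le> (norm x)\<^sup>2 + e"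
    using c by (simp add: field_simps c_def)
qed

lemma square_one_bound: "(cmod (\<omega> x))\<^sup>2 \<le> Re (\<omega> (star x * x))"
  using cauchy_schwarz[of 1 x] by (simp add: one)

lemma product_bound: "cmod (\<omega> (star x * y)) \<le> sqrt (Re (\<omega> (star x * x))) * norm y"
proof -
  have "(cmod (\<omega> (star x * y)))\<^sup>2 \<le> Re (\<omega> (star x * x)) * (norm y)\<^sup>2"
    using cauchy_schwarz[of x y] square_bound[of y] Re_pos[of x]
    by (meson mult_left_mono order_trans)
  then show ?thesis
    using real_le_rsqrt by (fastforce simp: real_sqrt_mult)
qed

lemma contractive: "cmod (\<omega> x) \<le> norm x"
  using product_bound[of 1 x] by (simp add: one)

lemma bounded_linear: "bounded_linear \<omega>"
proof (rule bounded_linear_intro[where K = 1])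
  show "\<omega> (r *\<^sub>R x) = r *\<^sub>R \<omega> x" for r x
    using scale[of "complex_of_real r" x] by (simp add: scaleC_of_real scaleR_conv_of_real)
qed (simp_all add: add contractive)

lemmas continuous [continuous_intros] = bounded_linear.continuous_on[OF bounded_linear]

end

text \<open>
  For an equicontinuous sequence of additive maps, pointwise convergence needs to be checked on a dense
  set only.
\<close>

lemma closed_convergent:
  fixes F :: "nat \<Rightarrow> 'a::real_normed_vector \<Rightarrow> 'b::banach"
  assumes diff: "\<And>n x y. F n (x - y) = F n x - F n y"
    and bound: "\<And>n x. norm (F n x) \<le> C * norm x"
  shows "closed {x. convergent (\<lambda>n. F n x)}"
  unfolding closed_sequential_limits
proof safe
  fix X x
  assume conv: "\<forall>m. X m \<in> {x. convergent (\<lambda>n. F n x)}" and lim: "X \<longlonglongrightarrow> x"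
  have "Cauchy (\<lambda>n. F n x)"
  proof (rule CauchyI)
    fix e :: real
    assume e: "0 < e"
    from LIMSEQ_D[OF lim, of "e / (3 * (\<bar>C\<bar> + 1))"] e obtain m where
      m: "norm (X m - x) < e / (3 * (\<bar>C\<bar> + 1))"
      by (metis abs_ge_zero add_nonneg_pos divide_pos_pos mult_pos_pos order_refl zero_less_numeral
          zero_less_one)
    have near: "norm (F n (X m) - F n x) < e / 3" for n
    proof -
      have "norm (F n (X m) - F n x) \<le> C * norm (X m - x)" using bound[of n "X m - x"] diff by simp
      also have "\<dots> \<le> (\<bar>C\<bar> + 1) * norm (X m - x)" by (rule mult_right_mono) auto
      also have "\<dots> < e / 3" using m by (simp add: field_simps)
      finally show ?thesis .
    qed
    have "Cauchy (\<lambda>n. F n (X m))" using conv by (simp add: convergent_Cauchy)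
    then obtain M where M: "\<And>k l. k \<ge> M \<Longrightarrow> l \<ge> M \<Longrightarrow> norm (F k (X m) - F l (X m)) < e / 3"
      using CauchyD[of _ "e / 3"] e by (metis zero_less_divide_iff zero_less_numeral)
    have "norm (F k x - F l x) < e" if "k \<ge> M" "l \<ge> M" for k l
    proof -
      have "F k x - F l x = (F k (X m) - F l (X m)) - (F k (X m) - F k x) + (F l (X m) - F l x)"
        by simp
      also have "norm \<dots> \<le> norm (F k (X m) - F l (X m)) + norm (F k (X m) - F k x)
          + norm (F l (X m) - F l x)"
        by (meson add_right_mono norm_triangle_ineq norm_triangle_ineq4 order_trans)
      also have "\<dots> < e" using near[of k] near[of l] M[OF that] by linarith
      finally show ?thesis .
    qed
    then show "\<exists>M. \<forall>k\<ge>M. \<forall>l\<ge>M. norm (F k x - F l x) < e" by blast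
  qed
  then show "convergent (\<lambda>n. F n x)" by (rule Cauchy_convergent)
qed

lemma closed_tendsto_zero:
  fixes F :: "nat \<Rightarrow> 'a::real_normed_vector \<Rightarrow> 'b::real_normed_vector"
  assumes diff: "\<And>n x y. F n (x - y) = F n x - F n y"
    and bound: "\<And>n x. norm (F n x) \<le> C * norm x"
  shows "closed {x. (\<lambda>n. F n x) \<longlonglongrightarrow> 0}"
  unfolding closed_sequential_limits
proof safe
  fix X x
  assume conv: "\<forall>m. X m \<in> {x. (\<lambda>n. F n x) \<longlonglongrightarrow> 0}" and lim: "X \<longlonglongrightarrow> x"
  show "(\<lambda>n. F n x) \<longlonglongrightarrow> 0"
  proof (rule LIMSEQ_I)
    fix e :: real
    assume e: "0 < e"
    from LIMSEQ_D[OF lim, of "e / (2 * (\<bar>C\<bar> + 1))"] e obtain m where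
      m: "norm (X m - x) < e / (2 * (\<bar>C\<bar> + 1))"
      by (metis abs_ge_zero add_nonneg_pos divide_pos_pos mult_pos_pos order_refl zero_less_numeral
          zero_less_one)
    have near: "norm (F n (X m) - F n x) < e / 2" for n
    proof -
      have "norm (F n (X m) - F n x) \<le> C * norm (X m - x)" using bound[of n "X m - x"] diff by simp
      also have "\<dots> \<le> (\<bar>C\<bar> + 1) * norm (X m - x)" by (rule mult_right_mono) auto
      also have "\<dots> < e / 2" using m by (simp add: field_simps)
      finally show ?thesis .
    qed
    from conv have "(\<lambda>n. F n (X m)) \<longlonglongrightarrow> 0" by simp
    from LIMSEQ_D[OF this, of "e / 2"] e obtain M where
      M: "\<And>k. k \<ge> M \<Longrightarrow> norm (F k (X m)) < e / 2" by auto
    have "norm (F k x - 0) < e" if "k \<ge> M" for k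
      using near[of k] M[OF that] norm_triangle_ineq4[of "F k (X m)" "F k (X m) - F k x"] by simp
    then show "\<exists>M. \<forall>k\<ge>M. norm (F k x - 0) < e" by blast
  qed
qed

lemma nonpos_if_multiples_bounded:
  fixes r M :: real
  assumes "\<And>K::nat. real K * r \<le> M"
  shows "r \<le> 0"
proof (rule ccontr)
  assume "\<not> r \<le> 0"
  then obtain K :: nat where "M < real K * r" using reals_Archimedean3[of r] by auto
  with assms[of K] show False by simp
qed


section \<open>Graded factors\<close>

lemma graded_cstar_algebraD:
  assumes "graded_cstar_algebra S \<gamma>"
  shows "cstar_subalgebra S"
    and "x \<in> S \<Longrightarrow> \<gamma> x \<in> S"
    and "x \<in> S \<Longrightarrow> y \<in> S \<Longrightarrow> \<gamma> (x + y) = \<gamma> x + \<gamma> y"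
    and "x \<in> S \<Longrightarrow> \<gamma> (z *\<^sub>C x) = z *\<^sub>C \<gamma> x"
    and "x \<in> S \<Longrightarrow> y \<in> S \<Longrightarrow> \<gamma> (x * y) = \<gamma> x * \<gamma> y"
    and "x \<in> S \<Longrightarrow> \<gamma> (star x) = star (\<gamma> x)"
    and "x \<in> S \<Longrightarrow> \<gamma> (\<gamma> x) = x"
  using assms
  by (auto simp: graded_cstar_algebra_def star_isomorphism_def clinear_on_def bij_betw_def)

lemma cstar_subalgebraD:
  assumes "cstar_subalgebra S"
  shows "closed S" and "1 \<in> S"
    and "x \<in> S \<Longrightarrow> y \<in> S \<Longrightarrow> x + y \<in> S"
    and "x \<in> S \<Longrightarrow> y \<in> S \<Longrightarrow> x * y \<in> S"
    and "x \<in> S \<Longrightarrow> z *\<^sub>C x \<in> S"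
    and "x \<in> S \<Longrightarrow> star x \<in> S"
  using assms by (auto simp: cstar_subalgebra_def)

lemma even_odd_decomposition:
  assumes gr: "graded_cstar_algebra S \<gamma>" and x: "x \<in> S"
  obtains y z where "y \<in> S" "z \<in> S" "\<gamma> y = y" "\<gamma> z = - z" "x = y + z"
proof
  note g = graded_cstar_algebraD[OF gr]
  note s = cstar_subalgebraD[OF g(1)]
  define y where "y = (1/2) *\<^sub>C (x + \<gamma> x)"
  define z where "z = (1/2) *\<^sub>C (x + (- 1) *\<^sub>C \<gamma> x)"
  have m: "\<gamma> x \<in> S" "(- 1) *\<^sub>C \<gamma> x \<in> S" using g(2)[OF x] s(5) by (blast, blast)
  show "y \<in> S" "z \<in> S" unfolding y_def z_def using x m s by blast+
  show "\<gamma> y = y"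
    unfolding y_def using x m s(3) by (simp add: g add.commute)
  have "\<gamma> z = (1/2) *\<^sub>C (\<gamma> x + (- 1) *\<^sub>C x)"
    unfolding z_def using x m s(3)
    by (simp only: g(3)[OF x m(2)] g(4)[OF s(3)[OF x m(2)]] g(4)[OF m(1)] g(7))
  then show "\<gamma> z = - z"
    by (simp add: z_def scaleC_diff_right)
  have "y + z = (1/2) *\<^sub>C x + (1/2) *\<^sub>C x"
    by (simp add: y_def z_def scaleC_diff_right scaleC_add_right)
  then show "x = y + z"
    by (simp flip: scaleC_add_left)
qed

lemma eq_minus_self_iff: "x = - x \<longleftrightarrow> x = (0::'a::real_vector)"
proof
  assume "x = - x"
  then have "2 *\<^sub>R x = 0" by (simp add: scaleR_2 eq_neg_iff_add_eq_0)
  then show "x = 0" by simp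
qed simp

lemma homogeneous_induct [consumes 2, case_names homogeneous add]:
  assumes gr: "graded_cstar_algebra S \<gamma>" and "x \<in> S"
    and h: "\<And>x. x \<in> homogeneous S \<gamma> \<Longrightarrow> P x"
    and "\<And>x y. x \<in> S \<Longrightarrow> y \<in> S \<Longrightarrow> P x \<Longrightarrow> P y \<Longrightarrow> P (x + y)"
  shows "P x"
proof -
  obtain y z where d: "y \<in> S" "z \<in> S" "\<gamma> y = y" "\<gamma> z = - z" "x = y + z"
    using even_odd_decomposition[OF gr \<open>x \<in> S\<close>] .
  then have "P y" "P z" by (auto intro!: h simp: homogeneous_def)
  with d assms(4) show ?thesis by blast
qed

text \<open>
  The structure of an infinite Fermi product that the proof works with: an increasing sequence of
  subalgebras \<open>\<BB> n\<close>, spanned by the factors up to \<open>n\<close>, such that the next factor commutes or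
  anticommutes with \<open>\<BB> n\<close> according to parity. The relation for odd \<open>b\<close> is written with the grading
  \<open>\<theta>\<close>, so that it holds for every element of \<open>\<BB> n\<close> and not just for homogeneous ones.
\<close>

locale graded_factors =
  fixes \<beta> :: "'b::cstar_algebra \<Rightarrow> 'b"
    and \<theta> :: "'a::cstar_algebra \<Rightarrow> 'a"
    and \<iota> :: "nat \<Rightarrow> 'b \<Rightarrow> 'a"
    and \<BB> :: "nat \<Rightarrow> 'a set"
  assumes graded_factor: "graded_cstar_algebra UNIV \<beta>"
    and graded_local: "graded_cstar_algebra (\<BB> n) \<theta>"
    and local_Suc: "\<BB> n \<subseteq> \<BB> (Suc n)"
    and factor_mem: "\<iota> n b \<in> \<BB> n"
    and factor_add: "\<iota> n (b + c) = \<iota> n b + \<iota> n c"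
    and factor_scale: "\<iota> n (z *\<^sub>C b) = z *\<^sub>C \<iota> n b"
    and factor_mult: "\<iota> n (b * c) = \<iota> n b * \<iota> n c"
    and factor_star: "\<iota> n (star b) = star (\<iota> n b)"
    and factor_one: "\<iota> n 1 = 1"
    and factor_grading: "\<theta> (\<iota> n b) = \<iota> n (\<beta> b)"
    and even_commute_Suc: "\<beta> b = b \<Longrightarrow> x \<in> \<BB> n \<Longrightarrow> \<iota> (Suc n) b * x = x * \<iota> (Suc n) b"
    and odd_commute_Suc: "\<beta> b = - b \<Longrightarrow> x \<in> \<BB> n \<Longrightarrow> \<iota> (Suc n) b * x = \<theta> x * \<iota> (Suc n) b"
    and local_0_eq: "\<BB> 0 = range (\<iota> 0)"
    and local_Suc_eq: "\<BB> (Suc n) = closure (cspan {x * \<iota> (Suc n) b | x b. x \<in> \<BB> n})"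
    and local_dense: "closure (\<Union>n. \<BB> n) = UNIV"
begin

lemmas local_subalgebra = cstar_subalgebraD[OF graded_cstar_algebraD(1)[OF graded_local]]
lemmas local_grading = graded_cstar_algebraD(2-)[OF graded_local]
lemmas factor_algebra = graded_cstar_algebraD(3-)[OF graded_factor, simplified]

lemma local_mono: "m \<le> n \<Longrightarrow> \<BB> m \<subseteq> \<BB> n"
  by (rule lift_Suc_mono_le[of \<BB>]) (rule local_Suc)

lemma even_commute:
  assumes "\<beta> b = b" and "x \<in> \<BB> n" and "n < k"
  shows "\<iota> k b * x = x * \<iota> k b"
  using assms even_commute_Suc[of b x "k - 1"] local_mono[of n "k - 1"] by (cases k) auto

lemma odd_commute:
  assumes "\<beta> b = - b" and "x \<in> \<BB> n" and "n < k"
  shows "\<iota> k b * x = \<theta> x * \<iota> k b"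
  using assms odd_commute_Suc[of b x "k - 1"] local_mono[of n "k - 1"] by (cases k) auto

lemma dense_induct:
  assumes "closed {x. P x}" and "\<And>n x. x \<in> \<BB> n \<Longrightarrow> P x"
  shows "P x"
proof -
  have "closure (\<Union>n. \<BB> n) \<subseteq> {x. P x}"
    by (rule closure_minimal) (use assms in auto)
  then show ?thesis using local_dense by auto
qed

definition monomial :: "(nat \<Rightarrow> 'b) \<Rightarrow> nat \<Rightarrow> 'a" where
  "monomial b n = prod_list (map (\<lambda>j. \<iota> j (b j)) [0..<Suc n])"

lemma monomial_0: "monomial b 0 = \<iota> 0 (b 0)"
  by (simp add: monomial_def)

lemma monomial_Suc: "monomial b (Suc n) = monomial b n * \<iota> (Suc n) (b (Suc n))"
  by (simp add: monomial_def mult.assoc)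

lemma monomial_mem: "monomial b n \<in> \<BB> n"
proof (induction n)
  case (Suc n)
  then show ?case
    using local_Suc[of n] local_subalgebra(4)[of _ "Suc n"] factor_mem[of "Suc n"]
    by (auto simp: monomial_Suc)
qed (simp add: monomial_0 factor_mem)

lemma monomial_cong: "(\<And>j. j \<le> n \<Longrightarrow> b j = c j) \<Longrightarrow> monomial b n = monomial c n"
  by (induction n) (simp_all add: monomial_0 monomial_Suc)

text \<open>
  Each \<open>\<BB> n\<close> is the closed span of the monomials up to \<open>n\<close>, in the form of an induction rule. In the
  step, the rule for \<open>\<BB> n\<close> is applied to the property of \<open>y\<close> that \<open>P\<close> holds for
  \<open>y * \<iota> (Suc n) b\<close>.
\<close>

lemma local_induct [consumes 1, case_names monomial add scale closed]:
  assumes "x \<in> \<BB> n"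
    and "\<And>b. P (monomial b n)"
    and "\<And>x y. P x \<Longrightarrow> P y \<Longrightarrow> P (x + y)"
    and "\<And>z x. P x \<Longrightarrow> P (z *\<^sub>C x)"
    and "closed {x. P x}"
  shows "P x"
  using assms
proof (induction n arbitrary: P x)
  case 0
  then obtain b where "x = \<iota> 0 b" using local_0_eq by auto
  with 0(2)[of "\<lambda>_. b"] show ?case by (simp add: monomial_0)
next
  case (Suc n)
  have gen: "P (y * \<iota> (Suc n) b)" if "y \<in> \<BB> n" for y b
    using that
  proof (rule Suc.IH[of y "\<lambda>y. P (y * \<iota> (Suc n) b)"])
    fix c
    have "monomial (c(Suc n := b)) (Suc n) = monomial c n * \<iota> (Suc n) b"
      using monomial_cong[of n "c(Suc n := b)" c] by (simp add: monomial_Suc)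
    with Suc.prems(2) show "P (monomial c n * \<iota> (Suc n) b)" by metis
  next
    show "closed {y. P (y * \<iota> (Suc n) b)}"
      using continuous_closed_vimage[OF Suc.prems(5), of "\<lambda>y. y * \<iota> (Suc n) b"]
      by (simp add: vimage_def)
  qed (auto simp: distrib_right scaleC_mult_left Suc.prems)
  have "P 0" using Suc.prems(4)[OF Suc.prems(2), of 0] by simp
  then have "cvector.subspace {x. P x}"
    using Suc.prems(3,4) by (auto intro!: cvector.subspaceI)
  then have "cspan {y * \<iota> (Suc n) b | y b. y \<in> \<BB> n} \<subseteq> {x. P x}"
    using gen by (intro cvector.span_minimal) auto
  then have "\<BB> (Suc n) \<subseteq> {x. P x}"
    unfolding local_Suc_eq using Suc.prems(5) by (rule closure_minimal)
  with Suc.prems(1) show ?case by auto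
qed

end

text \<open>
  Everything reduces to the two formulas \<open>x * \<iota> (Suc n) b = T n x b\<close> and
  \<open>\<iota> (Suc n) b * x = \<plusminus> T n x b\<close>, the latter for homogeneous elements, with the Fermi sign. Both follow
  from the product rule for elementary tensors since \<open>1\<close> is even and not odd.
\<close>

lemma infinite_fermi_product_graded_factors:
  assumes "infinite_fermi_product \<beta> \<theta> \<iota>"
  shows "\<exists>\<BB>. graded_factors \<beta> \<theta> \<iota> \<BB>"
proof -
  from assms obtain \<BB> T where gb: "graded_cstar_algebra UNIV \<beta>"
    and gt: "graded_cstar_algebra UNIV \<theta>"
    and i0: "star_isomorphism UNIV (\<BB> 0) (\<iota> 0)" "\<And>b. \<theta> (\<iota> 0 b) = \<iota> 0 (\<beta> b)"
    and ftp: "\<And>n. fermi_tensor_product (\<BB> n) \<theta> UNIV \<beta> (\<BB> (Suc n)) \<theta> (T n)"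
    and T1: "\<And>n a. a \<in> \<BB> n \<Longrightarrow> T n a 1 = a"
    and iS: "\<And>n b. \<iota> (Suc n) b = T n 1 b"
    and dense: "closure (\<Union>n. \<BB> n) = UNIV"
    unfolding infinite_fermi_product_def by blast
  have gr: "graded_cstar_algebra (\<BB> n) \<theta>" for n
    using ftp[of n] by (simp add: fermi_tensor_product_def)
  note alg = cstar_subalgebraD[OF graded_cstar_algebraD(1)[OF gr]]
  note gth = graded_cstar_algebraD(2-)[OF gt, simplified]
  note gbe = graded_cstar_algebraD(2-)[OF gb, simplified]
  have one: "\<theta> 1 = 1" "\<beta> 1 = 1"
    using gth(4)[of "\<theta> 1" 1] gth(6)[of 1] gbe(4)[of "\<beta> 1" 1] gbe(6)[of 1] by simp_all
  have not_odd: "(1::'b) \<noteq> - 1" "(1::'a) \<noteq> - 1"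
    by (simp_all add: eq_minus_self_iff)
  have hom1: "1 \<in> homogeneous (\<BB> n) \<theta>" "1 \<in> homogeneous UNIV \<beta>" for n
    using alg(2) one by (auto simp: homogeneous_def)
  have homB: "x \<in> homogeneous (\<BB> n) \<theta> \<Longrightarrow> x \<in> \<BB> n" for n x
    by (auto simp: homogeneous_def)
  have Tadd: "T n (x + y) b = T n x b + T n y b" if "x \<in> \<BB> n" "y \<in> \<BB> n" for n x y b
    using ftp[of n] that by (simp add: fermi_tensor_product_def algebraic_tensor_def clinear_on_def)
  have Tadd': "T n x (b + c) = T n x b + T n x c"
    and Tsc: "T n x (z *\<^sub>C b) = z *\<^sub>C T n x b" if "x \<in> \<BB> n" for n x b c z
    using ftp[of n] that by (simp_all add: fermi_tensor_product_def algebraic_tensor_def clinear_on_def)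
  have Tmult: "T n c d * T n c' d' = fermi_sign \<beta> \<theta> d c' *\<^sub>C T n (c * c') (d * d')"
    if "c \<in> homogeneous (\<BB> n) \<theta>" "d \<in> homogeneous UNIV \<beta>"
      "c' \<in> homogeneous (\<BB> n) \<theta>" "d' \<in> homogeneous UNIV \<beta>" for n c d c' d'
    using ftp[of n] that by (simp add: fermi_tensor_product_def)
  have Tstar: "star (T n c d) = fermi_sign \<theta> \<beta> c d *\<^sub>C T n (star c) (star d)"
    if "c \<in> homogeneous (\<BB> n) \<theta>" "d \<in> homogeneous UNIV \<beta>" for n c d
    using ftp[of n] that by (simp add: fermi_tensor_product_def)
  have Tgrad: "\<theta> (T n c d) = T n (\<theta> c) (\<beta> d)" if "c \<in> \<BB> n" for n c d
    using ftp[of n] that by (simp add: fermi_tensor_product_def)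
  have left: "x * \<iota> (Suc n) b = T n x b" if "x \<in> \<BB> n" for n x b
    using gr[of n] that
  proof (induction rule: homogeneous_induct)
    case (homogeneous x)
    have "b \<in> UNIV" by simp
    with gb show ?case
    proof (induction rule: homogeneous_induct)
      case (homogeneous b)
      have "T n x 1 * T n 1 b = T n x b"
        using Tmult[OF \<open>x \<in> _\<close> hom1(2) hom1(1) homogeneous] not_odd one
        by (simp add: fermi_sign_def)
      then show ?case using T1[OF homB[OF \<open>x \<in> _\<close>]] by (simp add: iS)
    next
      case (add b c)
      then show ?case using Tadd'[OF homB[OF \<open>x \<in> _\<close>]] Tadd'[OF alg(2)]
        by (simp add: iS distrib_left)
    qed
  next
    case (add x y)
    then show ?case by (simp add: Tadd distrib_right)
  qed
  have right: "\<iota> (Suc n) b * x = fermi_sign \<beta> \<theta> b x *\<^sub>C T n x b"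
    if "x \<in> homogeneous (\<BB> n) \<theta>" "b \<in> homogeneous UNIV \<beta>" for n x b
    using Tmult[OF hom1(1) that(2,1) hom1(2)] T1[OF homB[OF that(1)]] by (simp add: iS)
  \<comment> \<open>\<open>0\<close> is both even and odd, so the Fermi sign need not be \<open>1\<close> for the even element \<open>b = 0\<close>\<close>
  have zero_even: "b = 0" if "\<beta> b = b" "\<beta> b = - b" for b
    using that eq_minus_self_iff[of b] by simp
  have iadd: "\<iota> n (b + c) = \<iota> n b + \<iota> n c"
    and isc: "\<iota> n (z *\<^sub>C b) = z *\<^sub>C \<iota> n b" for n b c z
    using i0(1) Tadd'[OF alg(2)] Tsc[OF alg(2)]
    by (cases n; simp add: iS star_isomorphism_def clinear_on_def)+
  have izero: "\<iota> n 0 = 0" for n using isc[of n 0 0] by simp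
  have "graded_factors \<beta> \<theta> \<iota> \<BB>"
  proof
    fix n b c z x
    show "graded_cstar_algebra UNIV \<beta>" "graded_cstar_algebra (\<BB> n) \<theta>"
      "closure (\<Union>n. \<BB> n) = UNIV" by fact+
    show "\<iota> n (b + c) = \<iota> n b + \<iota> n c" "\<iota> n (z *\<^sub>C b) = z *\<^sub>C \<iota> n b" by fact+
    have Bcl: "\<BB> (Suc n) = closure (tensor_span (\<BB> n) UNIV (T n))" for n
      using ftp[of n] by (simp add: fermi_tensor_product_def)
    have "(y = T n c d \<and> c \<in> \<BB> n \<and> d \<in> UNIV) = (y = c * \<iota> (Suc n) d \<and> c \<in> \<BB> n)" for y c d
      using left by auto
    then have "{T n c d |c d. c \<in> \<BB> n \<and> d \<in> UNIV} = {x * \<iota> (Suc n) b |x b. x \<in> \<BB> n}"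
      by (simp only:)
    then show "\<BB> (Suc n) = closure (cspan {x * \<iota> (Suc n) b |x b. x \<in> \<BB> n})"
      by (simp add: Bcl[of n] tensor_span_def)
    have Tmem: "T n x b \<in> \<BB> (Suc n)" if "x \<in> \<BB> n" for n x b
    proof -
      have "T n x b \<in> tensor_span (\<BB> n) UNIV (T n)"
        unfolding tensor_span_def using that by (intro cvector.span_base) auto
      then show ?thesis using closure_subset Bcl by blast
    qed
    show "\<BB> n \<subseteq> \<BB> (Suc n)"
    proof
      fix y assume "y \<in> \<BB> n"
      then show "y \<in> \<BB> (Suc n)" using Tmem[of y n 1] T1[of y n] by simp
    qed
    show "\<iota> n b \<in> \<BB> n"
      using i0(1) Tmem[OF alg(2)] by (cases n) (auto simp: iS star_isomorphism_def bij_betw_def)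
    show "\<BB> 0 = range (\<iota> 0)" using i0(1) by (auto simp: star_isomorphism_def bij_betw_def)
    show "\<theta> (\<iota> n b) = \<iota> n (\<beta> b)"
      using i0(2) Tgrad[OF alg(2)] one by (cases n) (simp_all add: iS)
    show imult: "\<iota> n (b * c) = \<iota> n b * \<iota> n c" for n b c
    proof (cases n)
      case 0
      then show ?thesis using i0(1) by (simp add: star_isomorphism_def)
    next
      case (Suc m)
      have "b \<in> UNIV" by simp
      with gb have "\<iota> (Suc m) (b * c) = \<iota> (Suc m) b * \<iota> (Suc m) c"
      proof (induction rule: homogeneous_induct)
        case (homogeneous b)
        have "c \<in> UNIV" by simp
        with gb show ?case
        proof (induction rule: homogeneous_induct)
          case (homogeneous c)
          then show ?case
            using Tmult[OF hom1(1) \<open>b \<in> _\<close> hom1(1) homogeneous] not_odd one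
            by (simp add: iS fermi_sign_def)
        qed (simp add: distrib_left iadd)
      qed (simp add: distrib_right iadd)
      then show ?thesis by (simp add: Suc)
    qed
    show "\<iota> n (star b) = star (\<iota> n b)"
    proof (cases n)
      case 0
      then show ?thesis using i0(1) by (simp add: star_isomorphism_def)
    next
      case (Suc m)
      have "b \<in> UNIV" by simp
      with gb have "\<iota> (Suc m) (star b) = star (\<iota> (Suc m) b)"
      proof (induction rule: homogeneous_induct)
        case (homogeneous b)
        then show ?case
          using Tstar[OF hom1(1) homogeneous] not_odd one
          by (simp add: iS fermi_sign_def)
      qed (simp add: star_add iadd)
      then show ?thesis by (simp add: Suc)
    qed
    show "\<iota> n 1 = 1"
    proof (cases n)
      case 0
      have "1 \<in> range (\<iota> 0)" using alg(2)[of 0] i0(1) by (auto simp: star_isomorphism_def bij_betw_def)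
      then obtain u where "\<iota> 0 u = 1" by auto
      with imult[of 0 1 u] show ?thesis by (simp add: 0)
    next
      case (Suc m)
      then show ?thesis by (simp add: iS T1 alg)
    qed
    show "\<iota> (Suc n) b * x = x * \<iota> (Suc n) b" if ev: "\<beta> b = b" and x: "x \<in> \<BB> n"
      using gr x
    proof (induction rule: homogeneous_induct)
      case (homogeneous x)
      show ?case
      proof (cases "b = 0")
        case False
        then have "fermi_sign \<beta> \<theta> b x = 1" using ev zero_even by (auto simp: fermi_sign_def)
        then show ?thesis using right[OF homogeneous, of b] ev left[OF homB[OF homogeneous]]
          by (simp add: homogeneous_def)
      qed (simp add: izero)
    qed (simp add: distrib_left distrib_right)
    show "\<iota> (Suc n) b * x = \<theta> x * \<iota> (Suc n) b" if od: "\<beta> b = - b" and x: "x \<in> \<BB> n"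
      using gr x
    proof (induction rule: homogeneous_induct)
      case (homogeneous x)
      have r: "\<iota> (Suc n) b * x = fermi_sign \<beta> \<theta> b x *\<^sub>C (x * \<iota> (Suc n) b)"
        using right[OF homogeneous, of b] od left[OF homB[OF homogeneous]]
        by (simp add: homogeneous_def)
      show ?case
      proof (cases "\<theta> x = - x")
        case True
        then show ?thesis by (simp add: r fermi_sign_def od)
      next
        case False
        then have "\<theta> x = x" using homogeneous by (auto simp: homogeneous_def)
        with False show ?thesis by (simp add: r fermi_sign_def)
      qed
    qed (simp add: distrib_left distrib_right gth)
  qed
  then show ?thesis by blast
qed


section \<open>Extremality\<close>

text \<open>
  The sums \<open>y\<close> of \<open>K\<close> translates of \<open>b\<close> are built one translate at a time: clustering makes the new
  translate almost orthogonal to the sum obtained so far, so that \<open>\<omega> (star y * y)\<close> grows only linearly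
  in \<open>K\<close>, whereas \<open>(cmod (\<phi> y))\<^sup>2\<close> grows quadratically unless \<open>\<phi> b = 0\<close>.
\<close>

lemma strongly_clustering_dominated:
  assumes aut: "\<And>g. g \<in> finite_permutations \<Longrightarrow> star_isomorphism UNIV UNIV (\<alpha> g)"
    and \<omega>: "\<omega> \<in> symmetric_states \<alpha>" and \<phi>: "\<phi> \<in> symmetric_states \<alpha>"
    and clust: "strongly_clustering \<alpha> \<omega>"
    and dom: "\<And>x. Re (\<phi> (star x * x)) \<le> C * Re (\<omega> (star x * x))"
  shows "\<phi> = \<omega>"
proof
  fix a
  interpret state \<omega> using \<omega> by unfold_locales (simp add: symmetric_states_def)
  interpret \<phi>: state \<phi> using \<phi> by unfold_locales (simp add: symmetric_states_def)
  have inv: "\<omega> (\<alpha> g x) = \<omega> x" "\<phi> (\<alpha> g x) = \<phi> x" if "g \<in> finite_permutations" for g x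
    using \<omega> \<phi> that by (auto simp: symmetric_states_def fun_eq_iff)
  obtain g where g: "\<And>n. g n \<in> finite_permutations"
    and lim: "\<And>a b. (\<lambda>n. \<omega> (\<alpha> (g n) a * b)) \<longlonglongrightarrow> \<omega> a * \<omega> b"
    using clust by (auto simp: strongly_clustering_def)
  define b where "b = a - \<omega> a *\<^sub>C 1"
  define M where "M = Re (\<omega> (star b * b))"
  have "\<omega> (star b) = 0" by (simp add: b_def hermitian diff scale one)
  with lim[of "star b"] have lim0: "(\<lambda>n. \<omega> (\<alpha> (g n) (star b) * y)) \<longlonglongrightarrow> 0" for y by simp
  have hom: "\<alpha> (g n) (star x) = star (\<alpha> (g n) x)" "\<alpha> (g n) (x * y) = \<alpha> (g n) x * \<alpha> (g n) y" for n x y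
    using aut[OF g[of n]] by (auto simp: star_isomorphism_def)
  have "\<exists>y. \<phi> y = of_nat K * \<phi> b \<and> Re (\<omega> (star y * y)) \<le> real K * (M + 1)" for K
  proof (induction K)
    case 0
    then show ?case by (intro exI[of _ 0]) (simp add: zero \<phi>.zero)
  next
    case (Suc K)
    then obtain y where y: "\<phi> y = of_nat K * \<phi> b" "Re (\<omega> (star y * y)) \<le> real K * (M + 1)"
      by blast
    obtain n where n: "cmod (\<omega> (\<alpha> (g n) (star b) * y)) < 1/2"
      using LIMSEQ_D[OF lim0[of y], of "1/2"] by auto
    define x where "x = \<alpha> (g n) b"
    have "star (y + x) * (y + x) = star y * y + star x * x + star x * y + star (star x * y)"
      by (simp add: star_add star_mult star_star distrib_left distrib_right add_ac)
    then have "Re (\<omega> (star (y + x) * (y + x)))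
        = Re (\<omega> (star y * y)) + Re (\<omega> (star x * x)) + 2 * Re (\<omega> (star x * y))"
      by (simp add: add hermitian)
    moreover have "\<omega> (star x * x) = \<omega> (star b * b)"
      using inv(1)[OF g, of n "star b * b"] by (simp add: x_def hom)
    moreover have "Re (\<omega> (star x * y)) \<le> 1/2"
      using n complex_Re_le_cmod[of "\<omega> (star x * y)"] by (simp add: x_def hom)
    ultimately have "Re (\<omega> (star (y + x) * (y + x))) \<le> real (Suc K) * (M + 1)"
      using y(2) by (simp add: M_def algebra_simps)
    moreover have "\<phi> (y + x) = of_nat (Suc K) * \<phi> b"
      by (simp add: \<phi>.add y(1) x_def inv g algebra_simps)
    ultimately show ?case by blast
  qed
  then obtain y where y: "\<And>K. \<phi> (y K) = of_nat K * \<phi> b"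
    and yM: "\<And>K. Re (\<omega> (star (y K) * y K)) \<le> real K * (M + 1)" by metis
  have M0: "M \<ge> 0" by (simp add: M_def Re_pos)
  have C0: "C > 0"
    using dom[of 1] by (simp add: one \<phi>.one)
  have "real K * (cmod (\<phi> b))\<^sup>2 \<le> C * (M + 1)" for K
  proof (cases "K = 0")
    case True
    then show ?thesis using M0 C0 by simp
  next
    case False
    have "(real K * cmod (\<phi> b))\<^sup>2 = (cmod (\<phi> (y K)))\<^sup>2" by (simp add: y norm_mult)
    also have "\<dots> \<le> Re (\<phi> (star (y K) * y K))" by (rule \<phi>.square_one_bound)
    also have "\<dots> \<le> C * (real K * (M + 1))"
      using dom[of "y K"] mult_left_mono[OF yM[of K], of C] C0 by linarith
    finally have "real K * (real K * (cmod (\<phi> b))\<^sup>2) \<le> real K * (C * (M + 1))"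
      by (simp add: power2_eq_square algebra_simps)
    with False show ?thesis by simp
  qed
  then have "(cmod (\<phi> b))\<^sup>2 \<le> 0" by (rule nonpos_if_multiples_bounded)
  then have "\<phi> b = 0" by simp
  then show "\<phi> a = \<omega> a" by (simp add: b_def \<phi>.diff \<phi>.scale \<phi>.one)
qed

lemma strongly_clustering_imp_ergodic:
  assumes aut: "\<And>g. g \<in> finite_permutations \<Longrightarrow> star_isomorphism UNIV UNIV (\<alpha> g)"
    and \<omega>: "\<omega> \<in> symmetric_states \<alpha>"
    and clust: "strongly_clustering \<alpha> \<omega>"
  shows "ergodic_state \<alpha> \<omega>"
  unfolding ergodic_state_def extreme_point_of_def
proof (intro conjI ballI notI \<omega>)
  fix \<phi> \<psi>
  assume \<phi>: "\<phi> \<in> symmetric_states \<alpha>" and \<psi>: "\<psi> \<in> symmetric_states \<alpha>"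
    and "\<omega> \<in> open_segment \<phi> \<psi>"
  then obtain u where ne: "\<phi> \<noteq> \<psi>" and u: "0 < u" "u < 1"
    and eq: "\<omega> = (1 - u) *\<^sub>R \<phi> + u *\<^sub>R \<psi>" by (auto simp: in_segment)
  interpret \<phi>: state \<phi> using \<phi> by unfold_locales (simp add: symmetric_states_def)
  interpret \<psi>: state \<psi> using \<psi> by unfold_locales (simp add: symmetric_states_def)
  have val: "Re (\<omega> (star x * x)) = (1 - u) * Re (\<phi> (star x * x)) + u * Re (\<psi> (star x * x))" for x
    by (simp add: eq scaleR_fun_def)
  have "\<phi> = \<omega>"
  proof (rule strongly_clustering_dominated[OF aut \<omega> \<phi> clust])
    show "Re (\<phi> (star x * x)) \<le> 1 / (1 - u) * Re (\<omega> (star x * x))" for x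
      using u mult_nonneg_nonneg[of u "Re (\<psi> (star x * x))"] \<psi>.Re_pos[of x] val[of x]
      by (simp add: field_simps)
  qed
  moreover have "\<psi> = \<omega>"
  proof (rule strongly_clustering_dominated[OF aut \<omega> \<psi> clust])
    show "Re (\<psi> (star x * x)) \<le> 1 / u * Re (\<omega> (star x * x))" for x
      using u mult_nonneg_nonneg[of "1 - u" "Re (\<phi> (star x * x))"] \<phi>.Re_pos[of x] val[of x]
      by (simp add: field_simps)
  qed
  ultimately show False using ne by simp
qed

text \<open>
  Such a \<open>\<rho>\<close> exhibits \<open>\<omega>\<close> as a proper convex combination of the symmetric states \<open>\<rho> / t\<close> and
  \<open>(\<omega> - \<rho>) / (1 - t)\<close>, which must therefore coincide with \<open>\<omega>\<close>.
\<close>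

lemma ergodic_dominated_functional:
  assumes erg: "ergodic_state \<alpha> \<omega>"
    and add: "\<And>x y. \<rho> (x + y) = \<rho> x + \<rho> y"
    and scale: "\<And>z x. \<rho> (z *\<^sub>C x) = z * \<rho> x"
    and inv: "\<And>g x. g \<in> finite_permutations \<Longrightarrow> \<rho> (\<alpha> g x) = \<rho> x"
    and pos: "\<And>x. \<rho> (star x * x) \<in> \<real>\<^sub>\<ge>\<^sub>0"
    and dom: "\<And>x. \<omega> (star x * x) - \<rho> (star x * x) \<in> \<real>\<^sub>\<ge>\<^sub>0"
    and one: "\<rho> 1 = complex_of_real t" and t: "0 < t" "t < 1"
  shows "\<rho> x = t * \<omega> x"
proof -
  have \<omega>: "\<omega> \<in> symmetric_states \<alpha>"
    and ext: "\<And>\<phi> \<psi>. \<phi> \<in> symmetric_states \<alpha> \<Longrightarrow> \<psi> \<in> symmetric_states \<alpha> \<Longrightarrow> \<omega> \<notin> open_segment \<phi> \<psi>"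
    using erg by (auto simp: ergodic_state_def extreme_point_of_def)
  interpret \<omega>: state \<omega> using \<omega> by unfold_locales (simp add: symmetric_states_def)
  have inv\<omega>: "\<omega> (\<alpha> g x) = \<omega> x" if "g \<in> finite_permutations" for g x
    using \<omega> that by (auto simp: symmetric_states_def fun_eq_iff)
  define \<phi> where "\<phi> x = \<rho> x / t" for x
  define \<psi> where "\<psi> x = (\<omega> x - \<rho> x) / (1 - complex_of_real t)" for x
  have t': "1 - complex_of_real t = complex_of_real (1 - t)" by simp
  have \<phi>: "\<phi> \<in> symmetric_states \<alpha>"
    using pos t
    by (auto simp: \<phi>_def symmetric_states_def state_on_def clinear_on_def add scale one inv fun_eq_iff
        add_divide_distrib complex_nonneg_Reals_iff)
  have "1 / (1 - complex_of_real t) - complex_of_real t / (1 - complex_of_real t) = 1"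
    using t by (simp flip: diff_divide_distrib)
  then have \<psi>: "\<psi> \<in> symmetric_states \<alpha>"
    using dom t unfolding \<psi>_def t'
    by (auto simp: symmetric_states_def state_on_def clinear_on_def add scale one inv inv\<omega> fun_eq_iff
        add_divide_distrib diff_divide_distrib right_diff_distrib complex_nonneg_Reals_iff
        \<omega>.add \<omega>.scale \<omega>.one divide_right_mono)
  have comb: "\<omega> = (1 - (1 - t)) *\<^sub>R \<phi> + (1 - t) *\<^sub>R \<psi>"
    using t unfolding \<psi>_def t' \<phi>_def
    by (auto simp: fun_eq_iff scaleR_fun_def scaleR_conv_of_real)
  have no: "\<omega> \<notin> open_segment \<phi> \<psi>" by (rule ext[OF \<phi> \<psi>])
  have eq: "\<phi> = \<psi>"
  proof (rule ccontr)
    assume "\<phi> \<noteq> \<psi>"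
    then have "\<omega> \<in> open_segment \<phi> \<psi>"
      unfolding in_segment using t comb by (intro conjI exI[of _ "1 - t"]) simp_all
    with no show False by blast
  qed
  have "\<omega> x = \<phi> x"
    using fun_cong[OF comb, of x] by (simp add: eq scaleR_fun_def flip: scaleR_add_left)
  then show ?thesis using t by (simp add: \<phi>_def)
qed


section \<open>Symmetric states on graded factors\<close>

lemma transpose_finite_permutation: "Transposition.transpose j k \<in> finite_permutations"
  unfolding finite_permutations_def
  by (auto intro!: finite_subset[of _ "{j, k}"] simp: Transposition.transpose_def)

lemma finite_permutation_fixes_large:
  assumes "g \<in> finite_permutations"
  obtains N where "\<And>k. k \<ge> N \<Longrightarrow> g k = k"
proof -
  from assms have "finite {j. g j \<noteq> j}" by (simp add: finite_permutations_def)
  then obtain N where "{j. g j \<noteq> j} \<subseteq> {..<N}" using finite_nat_iff_bounded by blast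
  with that[of N] show thesis by fastforce
qed

locale symmetric_state = graded_factors \<beta> \<theta> \<iota> \<BB> + state \<omega>
  for \<beta> :: "'b::cstar_algebra \<Rightarrow> 'b"
    and \<theta> :: "'a::cstar_algebra \<Rightarrow> 'a"
    and \<iota> :: "nat \<Rightarrow> 'b \<Rightarrow> 'a"
    and \<BB> :: "nat \<Rightarrow> 'a set"
    and \<omega> :: "'a \<Rightarrow> complex" +
  fixes \<alpha> :: "(nat \<Rightarrow> nat) \<Rightarrow> 'a \<Rightarrow> 'a"
  assumes action: "permutation_action \<iota> \<alpha>"
    and symmetric: "\<omega> \<in> symmetric_states \<alpha>"
begin

lemma invariant: "g \<in> finite_permutations \<Longrightarrow> \<omega> (\<alpha> g x) = \<omega> x"
  using symmetric by (auto simp: symmetric_states_def fun_eq_iff)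

lemma
  assumes "g \<in> finite_permutations"
  shows action_add: "\<alpha> g (x + y) = \<alpha> g x + \<alpha> g y"
    and action_scale: "\<alpha> g (z *\<^sub>C x) = z *\<^sub>C \<alpha> g x"
    and action_mult: "\<alpha> g (x * y) = \<alpha> g x * \<alpha> g y"
    and action_star: "\<alpha> g (star x) = star (\<alpha> g x)"
    and action_factor: "\<alpha> g (\<iota> j b) = \<iota> (g j) b"
  using assms action
  by (auto simp: permutation_action_def star_isomorphism_def clinear_on_def fun_eq_iff)

lemma action_monomial:
  assumes "g \<in> finite_permutations"
  shows "\<alpha> g (monomial b n) = prod_list (map (\<lambda>j. \<iota> (g j) (b j)) [0..<Suc n])"
proof (induction n)
  case (Suc n)
  have "prod_list (map (\<lambda>j. \<iota> (g j) (b j)) [0..<Suc (Suc n)])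
      = prod_list (map (\<lambda>j. \<iota> (g j) (b j)) [0..<Suc n]) * \<iota> (g (Suc n)) (b (Suc n))"
    by (simp add: mult.assoc)
  then show ?case
    by (simp only: monomial_Suc action_mult[OF assms] action_factor[OF assms] Suc.IH)
qed (simp add: monomial_0 action_factor[OF assms])

lemma action_fixes_monomial:
  assumes "g \<in> finite_permutations" and "\<And>j. j \<le> n \<Longrightarrow> g j = j"
  shows "\<alpha> g (monomial b n) = monomial b n"
  unfolding action_monomial[OF assms(1)] unfolding monomial_def
  using assms(2) by (intro arg_cong[of _ _ prod_list] map_cong) auto

definition marginal :: "'b \<Rightarrow> complex" where
  "marginal b = \<omega> (\<iota> 0 b)"

lemma factor_value: "\<omega> (\<iota> k b) = marginal b"
  using invariant[OF transpose_finite_permutation[of 0 k], of "\<iota> 0 b"]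
  by (simp add: marginal_def action_factor[OF transpose_finite_permutation])

sublocale factor: state marginal
proof
  show "state_on UNIV marginal"
    using pos
    by (auto simp: state_on_def clinear_on_def marginal_def factor_add factor_scale factor_mult factor_star
        factor_one add scale one)
qed

lemma shift_outside:
  assumes "x \<in> \<BB> n" and "n < k" and "n < k'"
  shows "\<omega> (\<iota> k b * x) = \<omega> (\<iota> k' b * x)"
  using assms(1)
proof (induction rule: local_induct)
  case (monomial c)
  let ?g = "Transposition.transpose k k'"
  have "\<alpha> ?g (\<iota> k b * monomial c n) = \<iota> k' b * monomial c n"
    using assms(2,3) action_fixes_monomial[of ?g n c]
    by (simp add: transpose_finite_permutation action_mult action_factor Transposition.transpose_def)
  then show ?case using invariant[OF transpose_finite_permutation] by metis
next
  case closed
  show ?case by (intro closed_Collect_eq continuous_intros)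
qed (simp_all add: distrib_left scaleC_mult_right add scale)

text \<open>
  The sum \<open>Y K\<close> of \<open>K\<close> anticommuting copies of \<open>b\<close> has \<open>\<omega> (Y K * x) = K \<cdot> c\<close>, where \<open>c\<close> is the number in
  question, but \<open>\<omega> (Y K * star (Y K))\<close> is at most \<open>K \<cdot> M\<close>. Adding \<open>star (Y K) * Y K\<close>, which only
  increases the value, is what makes the mixed terms cancel.
\<close>

lemma odd_factor_vanishes:
  assumes odd: "\<beta> b = - b" and x: "x \<in> \<BB> n" and "n < k"
  shows "\<omega> (\<iota> k b * x) = 0"
proof -
  define Y where "Y K = (\<Sum>j<K. \<iota> (Suc n + j) b)" for K
  define M where "M = Re (marginal (star b * b + b * star b))"
  have odd_star: "\<beta> (star b) = - star b" using odd by (simp add: factor_algebra star_minus)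
  have \<beta>b: "\<iota> j (\<beta> b) = - \<iota> j b" "\<iota> j (\<beta> (star b)) = - star (\<iota> j b)" for j
    using factor_scale[of j "- 1"] by (simp_all add: odd odd_star flip: factor_star)
  have Y: "Y K \<in> \<BB> (n + K) \<and> \<theta> (Y K) = - Y K" for K
  proof (induction K)
    case 0
    have "\<theta> 0 = 0" using local_grading(3)[OF local_subalgebra(2), where z = 0] by simp
    then show ?case using local_subalgebra(5)[OF local_subalgebra(2), where z = 0] by (simp add: Y_def)
  next
    case (Suc K)
    then have m: "Y K \<in> \<BB> (n + Suc K)" "\<iota> (Suc n + K) b \<in> \<BB> (n + Suc K)"
      using local_Suc factor_mem[of "Suc n + K"] by auto
    have e: "Y (Suc K) = Y K + \<iota> (Suc n + K) b" by (simp add: Y_def)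
    show ?case unfolding e
      using Suc m local_subalgebra(3)[OF m] local_grading(2)[OF m]
      by (simp add: factor_grading \<beta>b del: add_Suc)
  qed
  have YY: "\<omega> (star (Y K) * Y K + Y K * star (Y K)) = of_nat K * marginal (star b * b + b * star b)" for K
  proof (induction K)
    case 0
    then show ?case by (simp add: Y_def zero)
  next
    case (Suc K)
    define y where "y = \<iota> (Suc n + K) b"
    have e: "Y (Suc K) = Y K + y" by (simp add: Y_def y_def)
    have sY: "star (Y K) \<in> \<BB> (n + K)" using Y local_subalgebra(6) by blast
    have "\<theta> (star (Y K)) = - star (Y K)"
      using Y[of K] local_grading(5)[OF conjunct1[OF Y[of K]]] by (simp add: star_minus)
    then have 1: "y * star (Y K) = - (star (Y K) * y)"
      using odd_commute[OF odd sY, of "Suc n + K"] by (simp add: y_def)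
    have 2: "star y * Y K = - (Y K * star y)"
      using odd_commute[OF odd_star, of "Y K" "n + K" "Suc n + K"] Y[of K]
      by (simp add: y_def factor_star)
    have "star (Y (Suc K)) * Y (Suc K) + Y (Suc K) * star (Y (Suc K))
        = (star (Y K) * Y K + Y K * star (Y K)) + (star y * y + y * star y)"
      by (simp add: e star_add distrib_left distrib_right 1 2)
    moreover have "star y * y + y * star y = \<iota> (Suc n + K) (star b * b + b * star b)"
      by (simp add: y_def factor_add factor_mult factor_star)
    ultimately have "\<omega> (star (Y (Suc K)) * Y (Suc K) + Y (Suc K) * star (Y (Suc K)))
        = of_nat K * marginal (star b * b + b * star b) + marginal (star b * b + b * star b)"
      using Suc.IH factor_value by (simp add: add)
    then show ?case by (simp add: algebra_simps)
  qed
  define c where "c = \<omega> (\<iota> k b * x)"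
  have Yx: "\<omega> (Y K * x) = of_nat K * c" for K
  proof (induction K)
    case (Suc K)
    have "\<omega> (\<iota> (Suc n + K) b * x) = c"
      unfolding c_def by (rule shift_outside[OF x]) (use assms in auto)
    with Suc show ?case by (simp add: Y_def distrib_right add algebra_simps)
  qed (simp add: Y_def zero)
  define N where "N = Re (\<omega> (star x * x))"
  have "real K * (cmod c)\<^sup>2 \<le> M * N" for K
  proof (cases "K = 0")
    case True
    have "M \<ge> 0" using factor.Re_pos[of b] factor.Re_pos[of "star b"]
      by (simp add: M_def factor.add star_star)
    moreover have "N \<ge> 0" by (simp add: N_def Re_pos)
    ultimately show ?thesis using True by simp
  next
    case False
    have "(real K * cmod c)\<^sup>2 = (cmod (\<omega> (star (star (Y K)) * x)))\<^sup>2"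
      by (simp add: Yx star_star norm_mult)
    also have "\<dots> \<le> Re (\<omega> (Y K * star (Y K))) * N"
      using cauchy_schwarz[of "star (Y K)" x] by (simp add: star_star N_def)
    also have "\<dots> \<le> (real K * M) * N"
    proof (rule mult_right_mono)
      have "Re (\<omega> (star (Y K) * Y K + Y K * star (Y K))) = real K * M"
        unfolding YY M_def by simp
      then show "Re (\<omega> (Y K * star (Y K))) \<le> real K * M"
        using Re_pos[of "Y K"] by (simp add: add)
    qed (simp add: N_def Re_pos)
    finally have "real K * (real K * (cmod c)\<^sup>2) \<le> real K * (M * N)"
      by (simp add: power2_eq_square algebra_simps)
    with False show ?thesis by simp
  qed
  then have "(cmod c)\<^sup>2 \<le> 0" by (rule nonpos_if_multiples_bounded)
  then show ?thesis by (simp add: c_def)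
qed

lemma factor_odd: "\<beta> b = - b \<Longrightarrow> marginal b = 0"
  using odd_factor_vanishes[of b 1 0 1] local_subalgebra(2)[of 0] factor_value[of 1 b] by simp

lemma factor_even_state: "marginal \<in> even_states UNIV \<beta>"
proof -
  have "marginal (\<beta> b) = marginal b" for b
  proof -
    have "b \<in> UNIV" by simp
    with graded_factor show ?thesis
    proof (induction rule: homogeneous_induct)
      case (homogeneous b)
      then show ?case
        using factor_odd[of b] by (auto simp: homogeneous_def factor.minus)
    qed (simp add: factor_algebra factor.add)
  qed
  then show ?thesis by (simp add: even_states_def factor.state)
qed

text \<open>
  The functional obtained by placing \<open>b\<close> in a factor infinitely far away; \<open>asymptotic_limit\<close> shows that
  the limit exists.
\<close>

definition asymptotic :: "'b \<Rightarrow> 'a \<Rightarrow> complex" where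
  "asymptotic b x = lim (\<lambda>k. \<omega> (\<iota> k b * x))"

text \<open>The point of this bound is that it does not depend on \<open>k\<close>.\<close>

lemma factor_bound: "cmod (\<omega> (\<iota> k b * x)) \<le> sqrt (Re (marginal (b * star b))) * norm x"
proof -
  have "\<omega> (star (\<iota> k (star b)) * \<iota> k (star b)) = marginal (b * star b)"
    using factor_value[of k "b * star b"] by (simp add: factor_star factor_mult star_star)
  then show ?thesis
    using product_bound[of "\<iota> k (star b)" x] by (simp add: factor_star star_star)
qed

lemma local_limit:
  assumes "x \<in> \<BB> n" and "n < k"
  shows "(\<lambda>j. \<omega> (\<iota> j b * x)) \<longlonglongrightarrow> \<omega> (\<iota> k b * x)"
proof (rule tendsto_eventually)
  show "\<forall>\<^sub>F j in sequentially. \<omega> (\<iota> j b * x) = \<omega> (\<iota> k b * x)"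
    using shift_outside[OF assms(1) _ assms(2)] by (auto intro: eventually_sequentiallyI[of "Suc n"])
qed

lemma asymptotic_limit: "(\<lambda>k. \<omega> (\<iota> k b * x)) \<longlonglongrightarrow> asymptotic b x"
proof -
  have "convergent (\<lambda>k. \<omega> (\<iota> k b * x))"
  proof (rule dense_induct)
    show "closed {x. convergent (\<lambda>k. \<omega> (\<iota> k b * x))}"
      by (rule closed_convergent[OF _ factor_bound]) (simp add: right_diff_distrib diff)
  next
    fix n x assume "x \<in> \<BB> n"
    then show "convergent (\<lambda>k. \<omega> (\<iota> k b * x))" using local_limit[of x n "Suc n"] convergentI by blast
  qed
  then show ?thesis by (simp add: asymptotic_def convergent_LIMSEQ_iff)
qed

lemma asymptotic_local: "x \<in> \<BB> n \<Longrightarrow> n < k \<Longrightarrow> asymptotic b x = \<omega> (\<iota> k b * x)"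
  using LIMSEQ_unique[OF asymptotic_limit local_limit] .

lemma asymptotic_add: "asymptotic b (x + y) = asymptotic b x + asymptotic b y"
  using asymptotic_limit[of b "x + y"] tendsto_add[OF asymptotic_limit[of b x] asymptotic_limit[of b y]]
  by (simp add: distrib_left add LIMSEQ_unique)

lemma asymptotic_scale: "asymptotic b (z *\<^sub>C x) = z * asymptotic b x"
  using asymptotic_limit[of b "z *\<^sub>C x"] tendsto_mult[OF tendsto_const[of z] asymptotic_limit[of b x]]
  by (simp add: scaleC_mult_right scale LIMSEQ_unique)

lemma asymptotic_bound: "cmod (asymptotic b x) \<le> sqrt (Re (marginal (b * star b))) * norm x"
  by (rule LIMSEQ_le_const2[OF tendsto_norm[OF asymptotic_limit]]) (use factor_bound in blast)

lemma asymptotic_bounded_linear: "bounded_linear (asymptotic b)"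
proof (rule bounded_linear_intro)
  show "asymptotic b (r *\<^sub>R x) = r *\<^sub>R asymptotic b x" for r x
    using asymptotic_scale[of b "complex_of_real r" x] by (simp add: scaleC_of_real scaleR_conv_of_real)
  show "cmod (asymptotic b x) \<le> norm x * sqrt (Re (marginal (b * star b)))" for x
    using asymptotic_bound by (simp add: mult.commute)
qed (rule asymptotic_add)

lemma asymptotic_invariant:
  assumes g: "g \<in> finite_permutations"
  shows "asymptotic b (\<alpha> g x) = asymptotic b x"
proof -
  obtain N where N: "\<And>k. k \<ge> N \<Longrightarrow> g k = k" using finite_permutation_fixes_large[OF g] by metis
  have "\<forall>\<^sub>F k in sequentially. \<omega> (\<iota> k b * x) = \<omega> (\<iota> k b * \<alpha> g x)"
  proof (rule eventually_sequentiallyI)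
    fix k assume "N \<le> k"
    then have "\<alpha> g (\<iota> k b * x) = \<iota> k b * \<alpha> g x"
      by (simp add: action_mult[OF g] action_factor[OF g] N)
    then show "\<omega> (\<iota> k b * x) = \<omega> (\<iota> k b * \<alpha> g x)" using invariant[OF g] by metis
  qed
  with asymptotic_limit[of b x] have "(\<lambda>k. \<omega> (\<iota> k b * \<alpha> g x)) \<longlonglongrightarrow> asymptotic b x"
    by (rule Lim_transform_eventually)
  with asymptotic_limit show ?thesis by (rule LIMSEQ_unique)
qed

lemma asymptotic_one: "asymptotic b 1 = marginal b"
  using asymptotic_local[OF local_subalgebra(2), of 0 1 b] factor_value[of 1 b] by simp

text \<open>
  For \<open>x\<close> in \<open>\<BB> n\<close> the even element \<open>star i * i\<close>, with \<open>i = \<iota> (Suc n) c\<close>, can be moved across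
  \<open>star x\<close>, which gives \<open>star (i * x) * (i * x)\<close>. Parity is
  demanded of \<open>star c * c\<close> because the square roots \<open>c\<close> inserted later are known by their squares only.
\<close>

lemma asymptotic_positive:
  assumes even: "\<beta> (star c * c) = star c * c"
  shows "asymptotic (star c * c) (star x * x) \<in> \<real>\<^sub>\<ge>\<^sub>0"
proof (rule dense_induct[where P = "\<lambda>x. asymptotic (star c * c) (star x * x) \<in> \<real>\<^sub>\<ge>\<^sub>0"])
  have "closed ((\<lambda>x. asymptotic (star c * c) (star x * x)) -` \<real>\<^sub>\<ge>\<^sub>0)"
    by (intro continuous_closed_vimage closed_nonneg_Reals_complex
        bounded_linear.continuous[OF asymptotic_bounded_linear] continuous_mult
        bounded_linear.continuous[OF bounded_linear_star] continuous_ident)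
  then show "closed {x. asymptotic (star c * c) (star x * x) \<in> \<real>\<^sub>\<ge>\<^sub>0}"
    by (simp add: vimage_def)
next
  fix n x assume x: "x \<in> \<BB> n"
  define i where "i = \<iota> (Suc n) c"
  have i: "\<iota> (Suc n) (star c * c) = star i * i" by (simp add: i_def factor_mult factor_star)
  have "asymptotic (star c * c) (star x * x) = \<omega> (star i * i * (star x * x))"
    using asymptotic_local[of "star x * x" n "Suc n"] x local_subalgebra(4,6) by (simp add: i)
  also have "star i * i * (star x * x) = star (i * x) * (i * x)"
    using even_commute[OF even, of "star x" n "Suc n"] local_subalgebra(6)[OF x]
    by (simp add: i star_mult mult.assoc[symmetric])
  finally show "asymptotic (star c * c) (star x * x) \<in> \<real>\<^sub>\<ge>\<^sub>0" using pos by simp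
qed


lemma asymptotic_add_left: "asymptotic (b + c) x = asymptotic b x + asymptotic c x"
  using asymptotic_limit[of "b + c" x] tendsto_add[OF asymptotic_limit[of b x] asymptotic_limit[of c x]]
  by (simp add: factor_add distrib_right add LIMSEQ_unique)

lemma asymptotic_scale_left: "asymptotic (z *\<^sub>C b) x = z * asymptotic b x"
  using asymptotic_limit[of "z *\<^sub>C b" x] tendsto_mult[OF tendsto_const[of z] asymptotic_limit[of b x]]
  by (simp add: factor_scale scaleC_mult_left scale LIMSEQ_unique)

lemma asymptotic_one_left: "asymptotic 1 x = \<omega> x"
  using LIMSEQ_unique[OF asymptotic_limit[of 1 x], of "\<omega> x"] by (simp add: factor_one)

lemma asymptotic_odd:
  assumes "\<beta> b = - b"
  shows "asymptotic b x = 0"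
proof (rule dense_induct)
  show "closed {x. asymptotic b x = 0}"
    by (intro closed_Collect_eq continuous_intros
        bounded_linear.continuous_on[OF asymptotic_bounded_linear])
  show "asymptotic b x = 0" if "x \<in> \<BB> n" for n x
    using asymptotic_local[OF that, of "Suc n"] odd_factor_vanishes[OF assms that, of "Suc n"] by simp
qed

text \<open>
  Both \<open>(1 + h) / 2\<close> and \<open>(1 - h) / 2\<close> have self-adjoint square roots, so the functional of the first is
  positive and dominated by \<open>\<omega>\<close>. Its value at \<open>1\<close> is \<open>t = (1 + marginal h) / 2\<close>, which lies strictly
  between \<open>0\<close> and \<open>1\<close>, as a proper convex combination requires.
\<close>

lemma ergodic_asymptotic_small:
  assumes erg: "ergodic_state \<alpha> \<omega>"
    and even: "\<beta> h = h" and sa: "star h = h" and small: "norm h < 1"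
  shows "asymptotic h x = marginal h * \<omega> x"
proof -
  \<comment> \<open>\<open>a 1\<close> and \<open>a (- 1)\<close> are positive, even and add up to \<open>1\<close>\<close>
  define a where "a r = (1/2) *\<^sub>C (1 + r *\<^sub>C h)" for r
  have square: "\<exists>c. star c * c = a (complex_of_real r)" if "\<bar>r\<bar> = 1" for r
  proof -
    have "star (r *\<^sub>R h) = r *\<^sub>R h" "norm (r *\<^sub>R h) < 1"
      using that small by (simp_all add: star_scaleR sa)
    from self_adjoint_sqrt[OF this] obtain s where s: "star s = s" "s * s = 1 + r *\<^sub>R h" by blast
    have "star (sqrt (1/2) *\<^sub>R s) * (sqrt (1/2) *\<^sub>R s) = (1/2::real) *\<^sub>R (1 + r *\<^sub>R h)"
      by (simp add: star_scaleR s flip: real_sqrt_mult)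
    also have "\<dots> = a (complex_of_real r)"
      using scaleC_of_real[of "1/2" "1 + r *\<^sub>R h"] by (simp add: a_def scaleC_of_real)
    finally show ?thesis by blast
  qed
  have \<beta>1: "\<beta> 1 = 1" using factor_algebra(3)[of "\<beta> 1" 1] factor_algebra(5)[of 1] by simp
  have \<beta>a: "\<beta> (a r) = a r" for r by (simp add: a_def factor_algebra even \<beta>1)
  have pos_a: "asymptotic (a (complex_of_real r)) (star x * x) \<in> \<real>\<^sub>\<ge>\<^sub>0" if "\<bar>r\<bar> = 1" for r x
    using square[OF that] asymptotic_positive \<beta>a by metis
  have a_val: "asymptotic (a r) x = (\<omega> x + r * asymptotic h x) / 2" for r x
    by (simp add: a_def asymptotic_add_left asymptotic_scale_left asymptotic_one_left)
  have real: "marginal h = complex_of_real (Re (marginal h))"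
    using factor.hermitian[of h] by (simp add: sa complex_eq_iff)
  define t where "t = (1 + Re (marginal h)) / 2"
  have "\<bar>Re (marginal h)\<bar> < 1"
    using abs_Re_le_cmod[of "marginal h"] factor.contractive[of h] small by linarith
  then have t: "0 < t" "t < 1" by (simp_all add: t_def)
  have "asymptotic (a 1) x = t * \<omega> x"
  proof (rule ergodic_dominated_functional[OF erg, where \<rho> = "asymptotic (a 1)" and t = t])
    show "asymptotic (a 1) (star x * x) \<in> \<real>\<^sub>\<ge>\<^sub>0" for x
      using pos_a[of 1] by simp
    have "\<omega> y - asymptotic (a 1) y = asymptotic (a (- 1)) y" for y
      by (simp add: a_val field_simps)
    then show "\<omega> (star x * x) - asymptotic (a 1) (star x * x) \<in> \<real>\<^sub>\<ge>\<^sub>0" for x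
      using pos_a[of "- 1"] by simp
    show "asymptotic (a 1) 1 = complex_of_real t"
      using real unfolding a_val by (simp add: asymptotic_one one t_def)
  qed (use t in \<open>simp_all add: asymptotic_add asymptotic_scale asymptotic_invariant\<close>)
  moreover have "complex_of_real t = (1 + marginal h) / 2" using real by (simp add: t_def)
  ultimately show ?thesis by (simp add: a_val field_simps)
qed

lemma ergodic_asymptotic:
  assumes erg: "ergodic_state \<alpha> \<omega>"
  shows "asymptotic b x = marginal b * \<omega> x"
proof -
  have sa: "asymptotic h x = marginal h * \<omega> x" if "\<beta> h = h" "star h = h" for h
  proof -
    define r where "r = norm h + 1"
    have r: "r > 0" by (simp add: r_def add_nonneg_pos)
    define h' where "h' = complex_of_real (1 / r) *\<^sub>C h"
    have "norm h' < 1" using r by (simp add: h'_def norm_scaleC norm_divide) (simp add: r_def)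
    moreover have "\<beta> h' = h'" "star h' = h'"
      using that by (simp_all add: h'_def factor_algebra star_scaleC)
    ultimately have "asymptotic h' x = marginal h' * \<omega> x" by (intro ergodic_asymptotic_small erg)
    then show ?thesis
      using r by (simp add: h'_def asymptotic_scale_left factor.scale)
  qed
  have even: "asymptotic b x = marginal b * \<omega> x" if "\<beta> b = b" for b
  proof -
    define h where "h = (1/2) *\<^sub>C (b + star b)"
    define k where "k = (- \<i>/2) *\<^sub>C (b + (- 1) *\<^sub>C star b)"
    have \<beta>s: "\<beta> (star b) = star b" using that by (simp add: factor_algebra)
    have "\<beta> h = h" by (simp add: h_def factor_algebra that)
    moreover have "\<beta> k = k" unfolding k_def by (simp only: factor_algebra(1,2) that \<beta>s)
    moreover have "star h = h" by (simp add: h_def star_scaleC star_add star_star add.commute)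
    moreover have "star k = k"
      by (simp add: k_def star_scaleC star_diff star_star scaleC_diff_right)
    ultimately have "asymptotic h x = marginal h * \<omega> x" "asymptotic k x = marginal k * \<omega> x"
      by (auto intro: sa)
    moreover have "b = h + \<i> *\<^sub>C k"
    proof -
      have "h + \<i> *\<^sub>C k = (1/2) *\<^sub>C b + (1/2) *\<^sub>C b"
        by (simp add: h_def k_def scaleC_scaleC scaleC_add_right scaleC_diff_right)
      then show ?thesis by (simp flip: scaleC_add_left)
    qed
    ultimately show ?thesis
      by (simp add: asymptotic_add_left asymptotic_scale_left factor.add factor.scale distrib_right)
  qed
  have "b \<in> UNIV" by simp
  with graded_factor show ?thesis
  proof (induction rule: homogeneous_induct)
    case (homogeneous b)
    then show ?case
      using even[of b] asymptotic_odd[of b] factor_odd[of b] by (auto simp: homogeneous_def)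
  qed (simp add: asymptotic_add_left factor.add distrib_right)
qed

text \<open>
  The functionals \<open>asymptotic b\<close> split off a factor on the left, whereas the last factor of a monomial
  stands on the right; taking adjoints exchanges the sides.
\<close>

lemma ergodic_imp_product:
  assumes erg: "ergodic_state \<alpha> \<omega>"
  shows "is_product_state \<iota> marginal \<omega>"
proof -
  have "\<omega> (monomial b n) = (\<Prod>j\<le>n. marginal (b j))" for b n
  proof (induction n)
    case 0
    then show ?case by (simp add: monomial_0 factor_value)
  next
    case (Suc n)
    define y where "y = monomial b n"
    have sy: "star y \<in> \<BB> n" unfolding y_def by (intro local_subalgebra(6) monomial_mem)
    define c where "c = b (Suc n)"
    have "\<omega> (y * \<iota> (Suc n) c) = cnj (\<omega> (\<iota> (Suc n) (star c) * star y))"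
      by (simp add: factor_star star_mult flip: hermitian) (simp add: star_star)
    also have "\<omega> (\<iota> (Suc n) (star c) * star y) = asymptotic (star c) (star y)"
      using asymptotic_local[OF sy, of "Suc n"] by simp
    also have "\<dots> = cnj (marginal c * \<omega> y)"
      by (simp add: ergodic_asymptotic[OF erg] hermitian factor.hermitian)
    finally show ?case using Suc.IH by (simp add: monomial_Suc y_def c_def mult.commute)
  qed
  then show ?thesis by (simp only: is_product_state_def state monomial_def) simp
qed

definition reversal :: "nat \<Rightarrow> nat \<Rightarrow> nat" where
  "reversal N j = (if j \<le> N then N - j else j)"

lemma reversal_finite_permutation: "reversal N \<in> finite_permutations"
proof -
  have "bij (reversal N)"
    by (rule o_bij[of "reversal N"]) (auto simp: reversal_def fun_eq_iff)
  moreover have "finite {j. reversal N j \<noteq> j}"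
    by (rule finite_subset[of _ "{..N}"]) (auto simp: reversal_def)
  ultimately show ?thesis by (simp add: finite_permutations_def)
qed

lemma product_value:
  assumes "is_product_state \<iota> \<psi> \<omega>"
  shows "\<omega> (monomial b n) = (\<Prod>j\<le>n. marginal (b j))"
proof -
  have val: "\<omega> (monomial b n) = (\<Prod>j\<le>n. \<psi> (b j))" for b n
    using assms by (simp only: is_product_state_def monomial_def)
  have "\<psi> b = marginal b" for b
    using val[of "\<lambda>_. b" 0] by (simp add: monomial_0 marginal_def)
  with val show ?thesis by simp
qed

lemma product_split_right:
  assumes prod: "is_product_state \<iota> \<psi> \<omega>" and "y \<in> \<BB> n"
  shows "\<omega> (y * \<iota> (Suc n) b) = \<omega> y * marginal b"
  using assms(2)
proof (induction rule: local_induct)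
  case (monomial c)
  have "monomial c n * \<iota> (Suc n) b = monomial (c(Suc n := b)) (Suc n)"
    using monomial_cong[of n "c(Suc n := b)" c] by (simp add: monomial_Suc)
  then show ?case by (simp add: product_value[OF prod])
next
  case closed
  show ?case by (intro closed_Collect_eq continuous_intros)
qed (simp_all add: distrib_right scaleC_mult_left add scale)

text \<open>
  An even element is first moved to the right of \<open>y\<close>. For an odd one both sides vanish, because \<open>\<omega>\<close> is
  symmetric.
\<close>

lemma product_split_left:
  assumes prod: "is_product_state \<iota> \<psi> \<omega>" and y: "y \<in> \<BB> n" and "n < k"
  shows "\<omega> (\<iota> k b * y) = marginal b * \<omega> y"
proof -
  have k: "\<omega> (\<iota> k b * y) = \<omega> (\<iota> (Suc n) b * y)" for b
    using shift_outside[OF y \<open>n < k\<close>, of "Suc n"] by simp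
  have "b \<in> UNIV" by simp
  with graded_factor show ?thesis unfolding k
  proof (induction rule: homogeneous_induct)
    case (homogeneous b)
    then consider "\<beta> b = b" | "\<beta> b = - b" by (auto simp: homogeneous_def)
    then show ?case
    proof cases
      case 1
      then show ?thesis
        using even_commute_Suc[OF 1 y] product_split_right[OF prod y] by simp
    next
      case 2
      then show ?thesis using odd_factor_vanishes[OF 2 y] factor_odd by simp
    qed
  qed (simp add: factor_add factor.add distrib_right add)
qed

text \<open>
  The indices decrease from left to right, so that, read from the right, each factor lies beyond
  everything that stands to its right and splits off.
\<close>

lemma product_reversed:
  assumes prod: "is_product_state \<iota> \<psi> \<omega>" and "y \<in> \<BB> p" and "p + m < N"
  shows "\<omega> (prod_list (map (\<lambda>j. \<iota> (N - j) (c j)) [0..<Suc m]) * y) = (\<Prod>j\<le>m. marginal (c j)) * \<omega> y"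
  using assms(2,3)
proof (induction m arbitrary: y p)
  case 0
  then show ?case using product_split_left[OF prod] by simp
next
  case (Suc m)
  define k where "k = N - Suc m"
  have k: "p < k" "k + m < N" using Suc.prems(2) by (auto simp: k_def)
  have mem: "\<iota> k (c (Suc m)) * y \<in> \<BB> k"
    using Suc.prems(1) local_mono[of p k] k(1) by (intro local_subalgebra(4) factor_mem) auto
  have "prod_list (map (\<lambda>j. \<iota> (N - j) (c j)) [0..<Suc (Suc m)]) * y
      = prod_list (map (\<lambda>j. \<iota> (N - j) (c j)) [0..<Suc m]) * (\<iota> k (c (Suc m)) * y)"
    by (simp add: k_def mult.assoc)
  then show ?case
    using Suc.IH[OF mem k(2)] product_split_left[OF prod Suc.prems(1) k(1)] by simp
qed

text \<open>
  For a monomial \<open>x\<close> and a local \<open>y\<close> the deviation \<open>E N x y\<close> is \<open>0\<close> for all large \<open>N\<close>; its bound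
  \<open>2 * norm x * norm y\<close>, a consequence of the invariance of \<open>\<omega>\<close>, carries the convergence to all \<open>x\<close> and \<open>y\<close>.
\<close>

lemma product_imp_strongly_clustering:
  assumes prod: "is_product_state \<iota> \<psi> \<omega>"
  shows "strongly_clustering \<alpha> \<omega>"
proof -
  define E where "E N x y = \<omega> (\<alpha> (reversal N) x * y) - \<omega> x * \<omega> y" for N x y
  note r = reversal_finite_permutation
  have bound: "cmod (E N x y) \<le> 2 * norm x * norm y" for N x y
  proof -
    have "\<omega> (star (\<alpha> (reversal N) (star x)) * \<alpha> (reversal N) (star x)) = \<omega> (star (star x) * star x)"
      using invariant[OF r, of N "star (star x) * star x"] by (simp add: action_mult[OF r] action_star[OF r])
    moreover have "sqrt (Re (\<omega> (star (star x) * star x))) \<le> norm x"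
      using square_bound[of "star x"] by (intro real_le_lsqrt) auto
    ultimately have "cmod (\<omega> (\<alpha> (reversal N) x * y)) \<le> norm x * norm y"
      using product_bound[of "\<alpha> (reversal N) (star x)" y]
        mult_right_mono[of "sqrt (Re (\<omega> (star (star x) * star x)))" "norm x" "norm y"]
      by (simp add: action_star[OF r] star_star)
    moreover have "cmod (\<omega> x * \<omega> y) \<le> norm x * norm y"
      unfolding norm_mult by (intro mult_mono contractive) auto
    ultimately show ?thesis
      using norm_triangle_ineq4[of "\<omega> (\<alpha> (reversal N) x * y)" "\<omega> x * \<omega> y"] by (simp add: E_def)
  qed
  have addl: "E N (x + x') y = E N x y + E N x' y" for N x x' y
    by (simp add: E_def action_add[OF r] add distrib_right)
  have scl: "E N (z *\<^sub>C x) y = z * E N x y" for N z x y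
    by (simp add: E_def action_scale[OF r] scaleC_mult_left scale right_diff_distrib)
  have diffl: "E N (x - x') y = E N x y - E N x' y" for N x x' y
    using addl[of N "x - x'" x' y] by simp
  have diffr: "E N x (y - y') = E N x y - E N x y'" for N x y y'
    by (simp add: E_def right_diff_distrib diff)
  have closl: "closed {x. (\<lambda>N. E N x y) \<longlonglongrightarrow> 0}" for y
    by (rule closed_tendsto_zero[where C = "2 * norm y"])
      (use bound diffl in \<open>simp_all add: mult_ac\<close>)
  have closr: "closed {y. (\<lambda>N. E N x y) \<longlonglongrightarrow> 0}" for x
    by (rule closed_tendsto_zero[where C = "2 * norm x"]) (use bound diffr in simp_all)
  have mono: "(\<lambda>N. E N (monomial c m) y) \<longlonglongrightarrow> 0" if y: "y \<in> \<BB> p" for c m y p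
  proof (rule tendsto_eventually, rule eventually_sequentiallyI)
    fix N assume N: "Suc (p + m) \<le> N"
    have "\<alpha> (reversal N) (monomial c m) = prod_list (map (\<lambda>j. \<iota> (N - j) (c j)) [0..<Suc m])"
      unfolding action_monomial[OF r] using N
      by (intro arg_cong[of _ _ prod_list] map_cong) (auto simp: reversal_def)
    then show "E N (monomial c m) y = 0"
      using product_reversed[OF prod y, of m N c] N by (simp only: E_def product_value[OF prod]) simp
  qed
  have loc: "(\<lambda>N. E N x y) \<longlonglongrightarrow> 0" if "x \<in> \<BB> m" and "y \<in> \<BB> p" for x y m p
    using that(1)
  proof (induction rule: local_induct)
    case (monomial c)
    show ?case by (rule mono[OF that(2)])
  next
    case (add x x')
    then show ?case using tendsto_add[OF add] by (simp add: addl)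
  next
    case (scale z x)
    then show ?case using tendsto_mult[OF tendsto_const[of z] scale] by (simp add: scl)
  next
    case closed
    show ?case by (rule closl)
  qed
  have "(\<lambda>N. E N x y) \<longlonglongrightarrow> 0" if "y \<in> \<BB> p" for x y p
    by (rule dense_induct[OF closl]) (rule loc[OF _ that])
  then have "(\<lambda>N. E N x y) \<longlonglongrightarrow> 0" for x y
    by (rule dense_induct[OF closr])
  then have "(\<lambda>N. \<omega> (\<alpha> (reversal N) x * y)) \<longlonglongrightarrow> \<omega> x * \<omega> y" for x y
    by (simp add: E_def LIM_zero_iff)
  then show ?thesis unfolding strongly_clustering_def using r by blast
qed

end

theorem theorem6p1:
  fixes \<beta> :: "'b::cstar_algebra \<Rightarrow> 'b"
    and \<theta> :: "'a::cstar_algebra \<Rightarrow> 'a"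
    and \<iota> :: "nat \<Rightarrow> 'b \<Rightarrow> 'a"
    and \<alpha> :: "(nat \<Rightarrow> nat) \<Rightarrow> 'a \<Rightarrow> 'a"
    and \<omega> :: "'a \<Rightarrow> complex"
  assumes "graded_cstar_algebra UNIV \<beta>"
    and "separable_space (euclidean :: 'b topology)"
    and "infinite_fermi_product \<beta> \<theta> \<iota>"
    and "permutation_action \<iota> \<alpha>"
    and "\<omega> \<in> symmetric_states \<alpha>"
  shows "(ergodic_state \<alpha> \<omega> \<longleftrightarrow> strongly_clustering \<alpha> \<omega>) \<and>
    (strongly_clustering \<alpha> \<omega> \<longleftrightarrow> (\<exists>\<phi>\<in>even_states UNIV \<beta>. is_product_state \<iota> \<phi> \<omega>))"
proof -
  obtain \<BB> where "graded_factors \<beta> \<theta> \<iota> \<BB>"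
    using infinite_fermi_product_graded_factors[OF assms(3)] by blast
  then interpret symmetric_state \<beta> \<theta> \<iota> \<BB> \<omega> \<alpha>
    using assms(4,5)
    by (auto simp: symmetric_state_def symmetric_state_axioms_def state_def symmetric_states_def)
  have "strongly_clustering \<alpha> \<omega> \<Longrightarrow> ergodic_state \<alpha> \<omega>"
    by (rule strongly_clustering_imp_ergodic)
      (use assms(4,5) in \<open>auto simp: permutation_action_def\<close>)
  then show ?thesis
    using ergodic_imp_product factor_even_state product_imp_strongly_clustering by blast
qed

end
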